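(* Let $K$ be a compact hyperbolic attractor of a smooth diffeomorphism $f$, let $\mathcal{O}=\{x_n\}_{n\in\mathbb{Z}}$, $x_{n+1}=f(x_n)$, be any orbit on $K$, and let $\omega\in\mathcal{X}^*(\mathcal{O})$ be any bounded covector sequence $\{\omega_n\in T^*_{x_n}\mathcal{M}\}_{n\in\mathbb{Z}}$. For $\nu\in\mathcal{X}^*(\mathcal{O})$, the following characterizations satisfy (c) $\Leftrightarrow$ (b) $\Rightarrow$ (a). (a) For any bounded vector sequence $X\in\mathcal{X}(\mathcal{O})$, $$\lim_{T\to\infty}\left(\frac1{2T+1}\sum_{n=-T}^T\omega_nS(X)_n-\frac1{2T+1}\sum_{n=-T}^T\nu_nX_n\right)=0 .$$ (b) $\nu$ has the expansion formula $$\nu=\sum_{n\ge0}f^{*n}\mathcal{P}^s\omega_n-\sum_{n\le-1}f^{*n}\mathcal{P}^u\omega_n ,$$ that is, $\nu_m=\sum_{n\ge0}f^{*n}\mathcal{P}^s\omega_{m+n}-\sum_{n\le-1}f^{*n}\mathcal{P}^u\omega_{m+n}$ for every $m\in\mathbb{Z}$. (c) $\nu$ is the unique bounded solution of the inhomogeneous adjoint equation $$\nu_n=f^*\nu_{n+1}+\omega_n\qquad(n\in\mathbb{Z}).$$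
   Context: $f$ is a smooth diffeomorphism of a smooth Riemannian manifold $\mathcal{M}$. $K$ is a compact hyperbolic set: $T_K\mathcal{M}$ has a continuous $f_*$-invariant splitting $T_K\mathcal{M}=V^s\oplus V^u$ and there are $C>0$, $0<\lambda<1$ with $|f_*^{-n}|_{V^u(x)}|,\ |f_*^{n}|_{V^s(x)}|\le C\lambda^n$ for all $x\in K$, $n\ge0$, where $f_*$ is the pushforward (differential). $K$ is an attractor: there is an open neighborhood $U$ of $K$ with $\bigcap_{n\ge0}f^nU=K$. $P^s,P^u$ are the projections onto $V^s,V^u$ along the splitting. The pullback $f^*:T^*_{fx}\mathcal{M}\to T^*_x\mathcal{M}$ is the adjoint of $f_*$: $(f^*\eta)(w)=\eta(f_*w)$; $f^{*n}=(f^* )^n$ for $n\in\mathbb{Z}$. The adjoint projections are $(\mathcal{P}^s\eta)(w)=\eta(P^sw)$, $(\mathcal{P}^u\eta)(w)=\eta(P^uw)$. The orbit $\mathcal{O}$ is given the discrete topology on all steps: points at different steps are counted as distinct even if they coincide in $\mathcal{M}$. $\mathcal{X}(\mathcal{O})$ and $\mathcal{X}^*(\mathcal{O})$ are the spaces of bounded sequences of vectors $\{X_n\in T_{x_n}\mathcal{M}\}_{n\in\mathbb{Z}}$ and covectors $\{\omega_n\in T^*_{x_n}\mathcal{M}\}_{n\in\mathbb{Z}}$. For a vector $X$ and covector $\omega$, $\omega X:=\omega(X)$. The (tangent) shadowing operator $S:\mathcal{X}(\mathcal{O})\to\mathcal{X}(\mathcal{O})$ sends $X$ to the unique bounded solution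 $v$ of $v_{n+1}=f_*v_n+X_{n+1}$, $n\in\mathbb{Z}$. *)

theory Defs
  imports "HOL-Analysis.Analysis"
begin

section \<open>Smooth manifolds\<close>

text \<open>
  A manifold is a second countable Hausdorff type with an atlas of charts into a Euclidean
  space.  A chart is a pair of its (open) domain and its coordinate map; outside the domain the
  coordinate map is irrelevant.
\<close>

type_synonym ('m, 'e) chart = "'m set \<times> ('m \<Rightarrow> 'e)"

definition chart_inv :: "('m, 'e) chart \<Rightarrow> 'e \<Rightarrow> 'm" where
  "chart_inv c = inv_into (fst c) (snd c)"

definition is_chart :: "('m::topological_space, 'e::euclidean_space) chart \<Rightarrow> bool" where
  "is_chart c \<longleftrightarrow> open (fst c) \<and> open (snd c ` fst c) \<and>
     homeomorphism (fst c) (snd c ` fst c) (snd c) (chart_inv c)"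

text \<open>To be used for open sets \<open>S\<close> only; \<open>C_k_on k\<close> is being \<open>k\<close> times continuously differentiable.\<close>

primrec C_k_on :: "nat \<Rightarrow> ('a::euclidean_space \<Rightarrow> 'b::real_normed_vector) \<Rightarrow> 'a set \<Rightarrow> bool" where
  "C_k_on 0 f S \<longleftrightarrow> continuous_on S f"
| "C_k_on (Suc k) f S \<longleftrightarrow> (\<forall>x\<in>S. f differentiable (at x)) \<and>
     (\<forall>v. C_k_on k (\<lambda>x. frechet_derivative f (at x) v) S)"

definition smooth_on :: "('a::euclidean_space \<Rightarrow> 'b::real_normed_vector) \<Rightarrow> 'a set \<Rightarrow> bool" where
  "smooth_on f S \<longleftrightarrow> (\<forall>k. C_k_on k f S)"

definition smooth_atlas ::
    "('m::{t2_space,second_countable_topology}, 'e::euclidean_space) chart set \<Rightarrow> bool" where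
  "smooth_atlas A \<longleftrightarrow>
     (\<forall>c\<in>A. is_chart c) \<and> (\<Union>c\<in>A. fst c) = UNIV \<and>
     (\<forall>c\<in>A. \<forall>d\<in>A. smooth_on (snd d \<circ> chart_inv c) (snd c ` (fst c \<inter> fst d)))"

definition smooth_map ::
    "('m::topological_space, 'e::euclidean_space) chart set \<Rightarrow> ('m \<Rightarrow> 'm) \<Rightarrow> bool" where
  "smooth_map A f \<longleftrightarrow> continuous_on UNIV f \<and>
     (\<forall>c\<in>A. \<forall>d\<in>A. smooth_on (snd d \<circ> f \<circ> chart_inv c) (snd c ` (fst c \<inter> f -` fst d)))"

definition diffeomorphism ::
    "('m::topological_space, 'e::euclidean_space) chart set \<Rightarrow> ('m \<Rightarrow> 'm) \<Rightarrow> bool" where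
  "diffeomorphism A f \<longleftrightarrow> bij f \<and> smooth_map A f \<and> smooth_map A (inv f)"


section \<open>Tangent and cotangent spaces\<close>

text \<open>
  For each point \<open>p\<close> one chart around \<open>p\<close> is singled out, and a tangent vector at \<open>p\<close> is
  represented by its coordinates in that chart.  So the fibres \<open>T\<^sub>p M\<close> and \<open>T\<^sub>p\<^sup>* M\<close> are, as
  vector spaces, the types \<open>'e\<close> and \<open>'e \<Rightarrow>\<^sub>L real\<close>, and the (co)tangent bundle as a set consists of
  pairs of a base point and a fibre element.  The singled-out chart jumps with \<open>p\<close>: anything that
  involves the topology or smooth structure of the bundle has to be transported into one fixed
  chart first, by means of \<open>from_chart\<close> below.
\<close>

definition chart_at :: "('m, 'e) chart set \<Rightarrow> 'm \<Rightarrow> ('m, 'e) chart" where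
  "chart_at A p = (SOME c. c \<in> A \<and> p \<in> fst c)"

text \<open>\<open>from_chart A c p u\<close> is the vector in \<open>T\<^sub>p M\<close> whose coordinates in the chart \<open>c\<close> are \<open>u\<close>.\<close>

definition from_chart ::
    "('m, 'e::euclidean_space) chart set \<Rightarrow> ('m, 'e) chart \<Rightarrow> 'm \<Rightarrow> 'e \<Rightarrow> 'e" where
  "from_chart A c p = frechet_derivative (snd (chart_at A p) \<circ> chart_inv c) (at (snd c p))"

text \<open>The differential \<open>f\<^sub>* : T\<^sub>p M \<rightarrow> T\<^bsub>f p\<^esub> M\<close>.\<close>

definition differential ::
    "('m, 'e::euclidean_space) chart set \<Rightarrow> ('m \<Rightarrow> 'm) \<Rightarrow> 'm \<Rightarrow> 'e \<Rightarrow>\<^sub>L 'e" where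
  "differential A f p =
     Blinfun (frechet_derivative (snd (chart_at A (f p)) \<circ> f \<circ> chart_inv (chart_at A p))
                (at (snd (chart_at A p) p)))"

text \<open>The pullback \<open>f\<^sup>* : T\<^sup>*\<^bsub>f p\<^esub> M \<rightarrow> T\<^sup>*\<^sub>p M\<close>.\<close>

definition codifferential ::
    "('m, 'e::euclidean_space) chart set \<Rightarrow> ('m \<Rightarrow> 'm) \<Rightarrow> 'm \<Rightarrow> ('e \<Rightarrow>\<^sub>L real) \<Rightarrow> ('e \<Rightarrow>\<^sub>L real)" where
  "codifferential A f p \<eta> = \<eta> o\<^sub>L differential A f p"

text \<open>The same maps on the whole (co)tangent bundle, where they can be iterated.\<close>

definition pushforward ::
    "('m, 'e::euclidean_space) chart set \<Rightarrow> ('m \<Rightarrow> 'm) \<Rightarrow> 'm \<times> 'e \<Rightarrow> 'm \<times> 'e" where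
  "pushforward A f = (\<lambda>(p, v). (f p, blinfun_apply (differential A f p) v))"

definition pullback ::
    "('m, 'e::euclidean_space) chart set \<Rightarrow> ('m \<Rightarrow> 'm) \<Rightarrow>
       'm \<times> ('e \<Rightarrow>\<^sub>L real) \<Rightarrow> 'm \<times> ('e \<Rightarrow>\<^sub>L real)" where
  "pullback A f = (\<lambda>(q, \<eta>). (inv f q, codifferential A f (inv f q) \<eta>))"

text \<open>The \<open>n\<close>-th iterate of a bijection, for an integer \<open>n\<close>.\<close>

definition int_iterate :: "('a \<Rightarrow> 'a) \<Rightarrow> int \<Rightarrow> 'a \<Rightarrow> 'a" where
  "int_iterate F n = (if n \<ge> 0 then F ^^ nat n else inv F ^^ nat (- n))"


section \<open>Riemannian metrics\<close>

definition riemannian_metric ::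
    "('m, 'e::euclidean_space) chart set \<Rightarrow> ('m \<Rightarrow> 'e \<Rightarrow> 'e \<Rightarrow> real) \<Rightarrow> bool" where
  "riemannian_metric A g \<longleftrightarrow>
     (\<forall>p. bilinear (g p) \<and> (\<forall>v w. g p v w = g p w v) \<and> (\<forall>v. v \<noteq> 0 \<longrightarrow> g p v v > 0)) \<and>
     (\<forall>c\<in>A. \<forall>u v. smooth_on
        (\<lambda>y. let p = chart_inv c y in g p (from_chart A c p u) (from_chart A c p v))
        (snd c ` fst c))"

definition vec_norm :: "('m \<Rightarrow> 'e \<Rightarrow> 'e \<Rightarrow> real) \<Rightarrow> 'm \<times> 'e \<Rightarrow> real" where
  "vec_norm g = (\<lambda>(p, v). sqrt (g p v v))"

definition covec_norm ::
    "('m \<Rightarrow> 'e::euclidean_space \<Rightarrow> 'e \<Rightarrow> real) \<Rightarrow> 'm \<times> ('e \<Rightarrow>\<^sub>L real) \<Rightarrow> real" where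
  "covec_norm g = (\<lambda>(p, \<eta>). SUP v\<in>{v. vec_norm g (p, v) \<le> 1}. \<bar>blinfun_apply \<eta> v\<bar>)"


section \<open>Hyperbolic attractors\<close>

text \<open>Continuous subbundle of the restriction of the tangent bundle to \<open>K\<close>: near each point of \<open>K\<close>
  it has a continuous frame, written here in the coordinates of one fixed chart.\<close>

definition continuous_subbundle ::
    "('m::topological_space, 'e::euclidean_space) chart set \<Rightarrow> 'm set \<Rightarrow> ('m \<Rightarrow> 'e set) \<Rightarrow> bool" where
  "continuous_subbundle A K V \<longleftrightarrow>
     (\<forall>p\<in>K. \<exists>c\<in>A. \<exists>N. open N \<and> p \<in> N \<and> N \<subseteq> fst c \<and>
        (\<exists>(k::nat) (e :: nat \<Rightarrow> 'm \<Rightarrow> 'e).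
           (\<forall>i<k. continuous_on (K \<inter> N) (e i)) \<and>
           (\<forall>q\<in>K \<inter> N. inj_on (\<lambda>i. e i q) {..<k} \<and> independent ((\<lambda>i. e i q) ` {..<k}) \<and>
              V q = from_chart A c q ` span ((\<lambda>i. e i q) ` {..<k}))))"

definition hyperbolic_set ::
    "('m::topological_space, 'e::euclidean_space) chart set \<Rightarrow> ('m \<Rightarrow> 'e \<Rightarrow> 'e \<Rightarrow> real) \<Rightarrow>
       ('m \<Rightarrow> 'm) \<Rightarrow> 'm set \<Rightarrow> ('m \<Rightarrow> 'e set) \<Rightarrow> ('m \<Rightarrow> 'e set) \<Rightarrow> bool" where
  "hyperbolic_set A g f K Vs Vu \<longleftrightarrow>
     f ` K = K \<and>
     (\<forall>p\<in>K. subspace (Vs p) \<and> subspace (Vu p) \<and>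
        Vs p \<inter> Vu p = {0} \<and> (\<forall>w. \<exists>a\<in>Vs p. \<exists>b\<in>Vu p. w = a + b)) \<and>
     continuous_subbundle A K Vs \<and> continuous_subbundle A K Vu \<and>
     (\<forall>p\<in>K. blinfun_apply (differential A f p) ` Vs p = Vs (f p) \<and>
             blinfun_apply (differential A f p) ` Vu p = Vu (f p)) \<and>
     (\<exists>C>0. \<exists>r. 0 < r \<and> r < 1 \<and>
        (\<forall>p\<in>K. \<forall>n::nat.
           (\<forall>v\<in>Vu p. vec_norm g (int_iterate (pushforward A f) (- int n) (p, v))
              \<le> C * r ^ n * vec_norm g (p, v)) \<and>
           (\<forall>v\<in>Vs p. vec_norm g (int_iterate (pushforward A f) (int n) (p, v))
              \<le> C * r ^ n * vec_norm g (p, v))))"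

definition attractor :: "('m::topological_space \<Rightarrow> 'm) \<Rightarrow> 'm set \<Rightarrow> bool" where
  "attractor f K \<longleftrightarrow> (\<exists>U. open U \<and> K \<subseteq> U \<and> (\<Inter>n::nat. (f ^^ n) ` U) = K)"

text \<open>The projection onto \<open>V p\<close> along \<open>W p\<close>.\<close>

definition proj_along :: "('m \<Rightarrow> 'e::euclidean_space set) \<Rightarrow> ('m \<Rightarrow> 'e set) \<Rightarrow> 'm \<Rightarrow> 'e \<Rightarrow>\<^sub>L 'e" where
  "proj_along V W p = Blinfun (\<lambda>w. THE a. a \<in> V p \<and> (\<exists>b\<in>W p. w = a + b))"

definition coproj_along ::
    "('m \<Rightarrow> 'e::euclidean_space set) \<Rightarrow> ('m \<Rightarrow> 'e set) \<Rightarrow>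
       'm \<times> ('e \<Rightarrow>\<^sub>L real) \<Rightarrow> 'm \<times> ('e \<Rightarrow>\<^sub>L real)" where
  "coproj_along V W = (\<lambda>(p, \<eta>). (p, \<eta> o\<^sub>L proj_along V W p))"


section \<open>Sequences along an orbit and shadowing\<close>

definition bounded_vecs ::
    "('m \<Rightarrow> 'e \<Rightarrow> 'e \<Rightarrow> real) \<Rightarrow> (int \<Rightarrow> 'm) \<Rightarrow> (int \<Rightarrow> 'e) set" where
  "bounded_vecs g x = {X. \<exists>B. \<forall>n. vec_norm g (x n, X n) \<le> B}"

definition bounded_covecs ::
    "('m \<Rightarrow> 'e::euclidean_space \<Rightarrow> 'e \<Rightarrow> real) \<Rightarrow> (int \<Rightarrow> 'm) \<Rightarrow> (int \<Rightarrow> 'e \<Rightarrow>\<^sub>L real) set" where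
  "bounded_covecs g x = {\<omega>. \<exists>B. \<forall>n. covec_norm g (x n, \<omega> n) \<le> B}"

definition shadowing ::
    "('m, 'e::euclidean_space) chart set \<Rightarrow> ('m \<Rightarrow> 'e \<Rightarrow> 'e \<Rightarrow> real) \<Rightarrow> ('m \<Rightarrow> 'm) \<Rightarrow>
       (int \<Rightarrow> 'm) \<Rightarrow> (int \<Rightarrow> 'e) \<Rightarrow> (int \<Rightarrow> 'e)" where
  "shadowing A g f x X =
     (THE v. v \<in> bounded_vecs g x \<and>
        (\<forall>n. v (n + 1) = blinfun_apply (differential A f (x n)) (v n) + X (n + 1)))"

definition adjoint_solution ::
    "('m, 'e::euclidean_space) chart set \<Rightarrow> ('m \<Rightarrow> 'e \<Rightarrow> 'e \<Rightarrow> real) \<Rightarrow> ('m \<Rightarrow> 'm) \<Rightarrow>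
       (int \<Rightarrow> 'm) \<Rightarrow> (int \<Rightarrow> 'e \<Rightarrow>\<^sub>L real) \<Rightarrow> (int \<Rightarrow> 'e \<Rightarrow>\<^sub>L real) \<Rightarrow> bool" where
  "adjoint_solution A g f x \<omega> \<nu> \<longleftrightarrow>
     \<nu> \<in> bounded_covecs g x \<and> (\<forall>n. \<nu> n = codifferential A f (x n) (\<nu> (n + 1)) + \<omega> n)"

text \<open>The \<open>n\<close>-th terms of the two series for the covector \<open>\<nu>\<^sub>m\<close>; as elements of the cotangent bundle
  they lie over \<open>x m\<close>.\<close>

definition expansion_term_s ::
    "('m, 'e::euclidean_space) chart set \<Rightarrow> ('m \<Rightarrow> 'm) \<Rightarrow> ('m \<Rightarrow> 'e set) \<Rightarrow> ('m \<Rightarrow> 'e set) \<Rightarrow>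
       (int \<Rightarrow> 'm) \<Rightarrow> (int \<Rightarrow> 'e \<Rightarrow>\<^sub>L real) \<Rightarrow> int \<Rightarrow> int \<Rightarrow> 'e \<Rightarrow>\<^sub>L real" where
  "expansion_term_s A f Vs Vu x \<omega> m n =
     snd (int_iterate (pullback A f) n (coproj_along Vs Vu (x (m + n), \<omega> (m + n))))"

definition expansion_term_u ::
    "('m, 'e::euclidean_space) chart set \<Rightarrow> ('m \<Rightarrow> 'm) \<Rightarrow> ('m \<Rightarrow> 'e set) \<Rightarrow> ('m \<Rightarrow> 'e set) \<Rightarrow>
       (int \<Rightarrow> 'm) \<Rightarrow> (int \<Rightarrow> 'e \<Rightarrow>\<^sub>L real) \<Rightarrow> int \<Rightarrow> int \<Rightarrow> 'e \<Rightarrow>\<^sub>L real" where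
  "expansion_term_u A f Vs Vu x \<omega> m n =
     snd (int_iterate (pullback A f) n (coproj_along Vu Vs (x (m + n), \<omega> (m + n))))"

text \<open>Convergence is that of the finite-dimensional space of covectors at \<open>x m\<close>.\<close>

definition expansion_formula ::
    "('m, 'e::euclidean_space) chart set \<Rightarrow> ('m \<Rightarrow> 'm) \<Rightarrow> ('m \<Rightarrow> 'e set) \<Rightarrow> ('m \<Rightarrow> 'e set) \<Rightarrow>
       (int \<Rightarrow> 'm) \<Rightarrow> (int \<Rightarrow> 'e \<Rightarrow>\<^sub>L real) \<Rightarrow> (int \<Rightarrow> 'e \<Rightarrow>\<^sub>L real) \<Rightarrow> bool" where
  "expansion_formula A f Vs Vu x \<omega> \<nu> \<longleftrightarrow>
     (\<forall>m. expansion_term_s A f Vs Vu x \<omega> m summable_on {0..} \<and>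
          expansion_term_u A f Vs Vu x \<omega> m summable_on {..-1} \<and>
          \<nu> m = (\<Sum>\<^sub>\<infinity>n\<in>{0..}. expansion_term_s A f Vs Vu x \<omega> m n)
              - (\<Sum>\<^sub>\<infinity>n\<in>{..-1}. expansion_term_u A f Vs Vu x \<omega> m n))"

end

theory Submission
  imports Defs
begin

text \<open>
  Near a point of \<open>K\<close>, continuous frames of both subbundles can be written in one chart, and a small
  perturbation of a frame does not change the angle between the subspaces much; by compactness the
  projections along the splitting are uniformly bounded in the Riemannian norm.  This uniform bound
  is what makes the shadowing operator exist.

  Since \<open>f\<^sub>*\<close> maps each of the two subbundles onto itself, it is invertible along an orbit in \<open>K\<close>, so all
  fibres over the orbit can be identified in such a way that \<open>f\<^sub>*\<close> becomes the identity of a fixed space.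
  The inhomogeneous equations then read \<open>v\<^sub>n\<^sub>+\<^sub>1 = v\<^sub>n + X\<^sub>n\<^sub>+\<^sub>1\<close> and \<open>\<nu>\<^sub>n = \<nu>\<^sub>n\<^sub>+\<^sub>1 + \<omega>\<^sub>n\<close>; the dynamics survives only in
  the dependence of the norms on \<open>n\<close>.  Bounded solutions are unique because a bounded constant sequence
  vanishes, and the geometrically convergent series solve the equations by an index shift.
  Finally \<open>\<omega>\<^sub>n v\<^sub>n - \<nu>\<^sub>n X\<^sub>n = \<nu>\<^sub>n v\<^sub>n\<^sub>-\<^sub>1 - \<nu>\<^sub>n\<^sub>+\<^sub>1 v\<^sub>n\<close> telescopes to a bounded quantity.
\<close>

section \<open>Transition maps and the metric in a chart\<close>

text \<open>The derivative of the coordinate change from \<open>c\<close> to \<open>d\<close> at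
  \<open>q\<close>. Both charts are free, unlike in \<open>from_chart\<close>, whose target is the
  chart selected at the point; this allows continuity to be discussed in two fixed charts.\<close>

definition transition ::
    "('m, 'e::euclidean_space) chart \<Rightarrow> ('m, 'e) chart \<Rightarrow> 'm \<Rightarrow> 'e \<Rightarrow> 'e" where
  "transition c d q = frechet_derivative (snd d \<circ> chart_inv c) (at (snd c q))"

lemma chart_inv_chart: "is_chart c \<Longrightarrow> q \<in> fst c \<Longrightarrow> chart_inv c (snd c q) = q"
  unfolding is_chart_def by (auto dest: homeomorphism_apply1)

lemma chart_at_mem:
  assumes "smooth_atlas A"
  shows "chart_at A p \<in> A" "p \<in> fst (chart_at A p)"
proof -
  have "\<exists>c. c \<in> A \<and> p \<in> fst c"
    using assms unfolding smooth_atlas_def by blast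
  then have "chart_at A p \<in> A \<and> p \<in> fst (chart_at A p)"
    unfolding chart_at_def by (rule someI_ex)
  then show "chart_at A p \<in> A" "p \<in> fst (chart_at A p)" by auto
qed

lemma from_chart_eq_transition: "from_chart A c p = transition c (chart_at A p) p"
  by (simp add: from_chart_def transition_def)

context
  fixes A :: "('m::{t2_space,second_countable_topology}, 'e::euclidean_space) chart set"
  assumes atlas: "smooth_atlas A"
begin

lemma atlas_chart: "c \<in> A \<Longrightarrow> is_chart c"
  using atlas by (simp add: smooth_atlas_def)

lemma open_chart_image:
  assumes "c \<in> A" "open V"
  shows "open (snd c ` (fst c \<inter> V))"
proof -
  have c: "open (fst c)" "open (snd c ` fst c)"
    "homeomorphism (fst c) (snd c ` fst c) (snd c) (chart_inv c)"
    using atlas_chart[OF assms(1)] by (auto simp: is_chart_def)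
  have "openin (top_of_set (fst c)) (fst c \<inter> V)"
    using assms(2) by (simp add: openin_open_Int)
  then have "openin (top_of_set (snd c ` fst c)) (snd c ` (fst c \<inter> V))"
    by (rule homeomorphism_imp_open_map[OF c(3)])
  then show ?thesis
    using c(2) openin_open_eq by blast
qed

lemma transition_has_derivative:
  assumes "c \<in> A" "d \<in> A" "q \<in> fst c" "q \<in> fst d"
  shows "(snd d \<circ> chart_inv c has_derivative transition c d q) (at (snd c q))"
proof -
  have "smooth_on (snd d \<circ> chart_inv c) (snd c ` (fst c \<inter> fst d))"
    using atlas assms by (simp add: smooth_atlas_def)
  then have "C_k_on (Suc 0) (snd d \<circ> chart_inv c) (snd c ` (fst c \<inter> fst d))"
    unfolding smooth_on_def by blast
  then have "(snd d \<circ> chart_inv c) differentiable (at (snd c q))"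
    using assms by auto
  then show ?thesis
    unfolding transition_def by (simp add: frechet_derivative_works)
qed

text \<open>Chain rule. The composite through \<open>d\<close> agrees with the direct coordinate
  change only over the overlap of \<open>c\<close> and \<open>d\<close>, so the two are compared on
  the open image of that overlap before uniqueness of the derivative is used.\<close>

lemma transition_trans:
  assumes "c \<in> A" "d \<in> A" "e \<in> A" "q \<in> fst c" "q \<in> fst d" "q \<in> fst e"
  shows "transition c e q = transition d e q \<circ> transition c d q"
proof -
  have d: "snd d q = (snd d \<circ> chart_inv c) (snd c q)"
    using chart_inv_chart[OF atlas_chart[OF assms(1)] assms(4)] by simp
  have "((snd e \<circ> chart_inv d) \<circ> (snd d \<circ> chart_inv c) has_derivative
      transition d e q \<circ> transition c d q) (at (snd c q))"
    using transition_has_derivative[OF assms(1,2,4,5)] transition_has_derivative[OF assms(2,3,5,6)]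
    unfolding d by (rule diff_chain_at)
  then have "(snd e \<circ> chart_inv c has_derivative
      transition d e q \<circ> transition c d q) (at (snd c q))"
  proof (rule has_derivative_transform_within_open)
    show "open (snd c ` (fst c \<inter> fst d))"
      using open_chart_image assms(1) atlas_chart[OF assms(2)] by (simp add: is_chart_def)
    show "snd c q \<in> snd c ` (fst c \<inter> fst d)"
      using assms by simp
    fix y assume "y \<in> snd c ` (fst c \<inter> fst d)"
    then show "((snd e \<circ> chart_inv d) \<circ> (snd d \<circ> chart_inv c)) y = (snd e \<circ> chart_inv c) y"
      using assms(1,2) by (auto simp: chart_inv_chart atlas_chart)
  qed
  then show ?thesis
    using transition_has_derivative[OF assms(1,3,4,6)] has_derivative_unique by blast
qed

lemma transition_self:
  assumes "c \<in> A" "q \<in> fst c"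
  shows "transition c c q = id"
proof -
  have "(id has_derivative id) (at (snd c q))"
    by (simp add: id_def)
  then have "(snd c \<circ> chart_inv c has_derivative id) (at (snd c q))"
  proof (rule has_derivative_transform_within_open)
    show "open (snd c ` (fst c \<inter> UNIV))"
      using open_chart_image assms(1) by blast
    fix y assume "y \<in> snd c ` (fst c \<inter> UNIV)"
    then show "id y = (snd c \<circ> chart_inv c) y"
      using assms(1) by (auto simp: chart_inv_chart atlas_chart)
  qed (use assms in auto)
  then show ?thesis
    using transition_has_derivative[OF assms(1,1,2,2)] has_derivative_unique by blast
qed

lemma transition_inverse:
  assumes "c \<in> A" "d \<in> A" "q \<in> fst c" "q \<in> fst d"
  shows "transition d c q (transition c d q v) = v"
  using transition_trans[OF assms(1,2,1,3,4,3)] transition_self[OF assms(1,3)]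
  by (metis comp_apply id_apply)

lemma inj_transition:
  assumes "c \<in> A" "d \<in> A" "q \<in> fst c" "q \<in> fst d"
  shows "inj (transition c d q)"
  by (rule injI) (metis transition_inverse[OF assms])

lemma linear_transition:
  assumes "c \<in> A" "d \<in> A" "q \<in> fst c" "q \<in> fst d"
  shows "linear (transition c d q)"
  using transition_has_derivative[OF assms] has_derivative_linear by blast

text \<open>Smoothness of the coordinate change gives continuity of its derivative in each fixed
  direction. For a varying vector \<open>u q\<close>, linearity reduces to the finitely many basis
  directions with continuous coefficients.\<close>

lemma continuous_on_transition:
  assumes "c \<in> A" "d \<in> A" "S \<subseteq> fst c \<inter> fst d" and u: "continuous_on S u"
  shows "continuous_on S (\<lambda>q. transition c d q (u q))"
proof -
  have "smooth_on (snd d \<circ> chart_inv c) (snd c ` (fst c \<inter> fst d))"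
    using atlas assms by (simp add: smooth_atlas_def)
  then have "C_k_on (Suc 0) (snd d \<circ> chart_inv c) (snd c ` (fst c \<inter> fst d))"
    unfolding smooth_on_def by blast
  then have D: "continuous_on (snd c ` (fst c \<inter> fst d))
      (\<lambda>y. frechet_derivative (snd d \<circ> chart_inv c) (at y) v)" for v
    by auto
  have c: "continuous_on (fst c) (snd c)"
    using atlas_chart[OF assms(1)] by (auto simp: is_chart_def homeomorphism_def)
  have "continuous_on S (\<lambda>q. transition c d q v)" for v
    unfolding transition_def
    using D[of v] continuous_on_subset[OF c]
    by (rule continuous_on_compose2) (use assms in auto)
  then have "continuous_on S (\<lambda>q. \<Sum>b\<in>Basis. (u q \<bullet> b) *\<^sub>R transition c d q b)"
    using u by (intro continuous_intros) auto
  moreover have "(\<Sum>b\<in>Basis. (u q \<bullet> b) *\<^sub>R transition c d q b) = transition c d q (u q)"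
    if "q \<in> S" for q
  proof -
    have l: "linear (transition c d q)"
      using linear_transition assms that by blast
    show ?thesis
      by (subst euclidean_representation[of "u q", symmetric])
        (simp add: linear_sum[OF l] linear_cmul[OF l] del: euclidean_representation)
  qed
  ultimately show ?thesis
    by (simp cong: continuous_on_cong)
qed

lemma linear_from_chart: "c \<in> A \<Longrightarrow> q \<in> fst c \<Longrightarrow> linear (from_chart A c q)"
  by (simp add: from_chart_eq_transition linear_transition chart_at_mem[OF atlas])

lemma inj_from_chart: "c \<in> A \<Longrightarrow> q \<in> fst c \<Longrightarrow> inj (from_chart A c q)"
  by (simp add: from_chart_eq_transition inj_transition chart_at_mem[OF atlas])

lemma from_chart_transition:
  assumes "c \<in> A" "d \<in> A" "q \<in> fst c" "q \<in> fst d"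
  shows "from_chart A d q (transition c d q v) = from_chart A c q v"
  using transition_trans[OF assms(1,2) chart_at_mem(1)[OF atlas] assms(3,4) chart_at_mem(2)[OF atlas]]
  unfolding from_chart_eq_transition by simp

end

section \<open>Comparison of the Riemannian norm with the coordinate norm near a point\<close>

lemma posdef_lower_bound:
  fixes h :: "'e::euclidean_space \<Rightarrow> 'e \<Rightarrow> real"
  assumes "bilinear h" "\<And>v. v \<noteq> 0 \<Longrightarrow> h v v > 0"
  shows "\<exists>m>0. \<forall>v. m * (norm v)\<^sup>2 \<le> h v v"
proof -
  interpret bounded_bilinear h
    using assms(1) by (simp add: bilinear_conv_bounded_bilinear)
  \<comment> \<open>The minimum over the compact unit sphere is the constant sought; homogeneity of
    degree two extends the bound to all vectors.\<close>
  have "continuous_on (sphere 0 1) (\<lambda>v. h v v)"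
    by (intro continuous_on continuous_intros)
  moreover have "sphere (0::'e) 1 \<noteq> {}" by simp
  ultimately obtain a where a: "a \<in> sphere 0 1" "\<And>v. v \<in> sphere 0 1 \<Longrightarrow> h a a \<le> h v v"
    using continuous_attains_inf[OF compact_sphere] by blast
  have "h a a * (norm v)\<^sup>2 \<le> h v v" for v
  proof (cases "v = 0")
    case False
    have "h a a \<le> h (v /\<^sub>R norm v) (v /\<^sub>R norm v)"
      using False by (intro a) simp
    also have "\<dots> = h v v / (norm v)\<^sup>2"
      by (simp add: scaleR_left scaleR_right power2_eq_square field_simps)
    finally show ?thesis using False by (simp add: field_simps)
  qed (simp add: zero_left)
  moreover have "a \<noteq> 0" using a(1) by auto
  then have "h a a > 0" by (rule assms(2))
  ultimately show ?thesis by blast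
qed

lemma bilinear_upper_bound:
  fixes h :: "'e::euclidean_space \<Rightarrow> 'e \<Rightarrow> real"
  assumes "bilinear h"
  shows "\<exists>M>0. \<forall>v. h v v \<le> M * (norm v)\<^sup>2"
proof -
  interpret bounded_bilinear h
    using assms(1) by (simp add: bilinear_conv_bounded_bilinear)
  obtain M where "M > 0" "\<And>a b. norm (h a b) \<le> norm a * norm b * M"
    using pos_bounded by blast
  then show ?thesis
    by (intro exI[of _ M]) (smt (verit) power2_eq_square mult.commute real_norm_def)
qed

text \<open>In one fixed chart the Gram matrix of the metric varies continuously, although the
  representation of each fibre jumps with the point. Hence two-sided bounds at \<open>p\<close>
  survive, with slightly worse constants, on a neighbourhood.\<close>

lemma chart_norm_equiv:
  fixes A :: "('m::{t2_space,second_countable_topology}, 'e::euclidean_space) chart set"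
  assumes atlas: "smooth_atlas A" and met: "riemannian_metric A g"
    and c: "c \<in> A" "p \<in> fst c"
  shows "\<exists>W m M. open W \<and> p \<in> W \<and> W \<subseteq> fst c \<and> m > 0 \<and> M > 0 \<and>
    (\<forall>q\<in>W. \<forall>u. m * norm u \<le> vec_norm g (q, from_chart A c q u) \<and>
                vec_norm g (q, from_chart A c q u) \<le> M * norm u)"
proof -
  define G where "G q u v = g q (from_chart A c q u) (from_chart A c q v)" for q u v
  have bil: "bilinear (G q)" if "q \<in> fst c" for q
  proof -
    have "bilinear (g q)" using met by (simp add: riemannian_metric_def)
    then show ?thesis
      using linear_from_chart[OF atlas c(1) that] unfolding bilinear_def G_def
      by (auto intro: linear_compose[unfolded comp_def])
  qed
  have "G p v v > 0" if "v \<noteq> 0" for v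
  proof -
    have "from_chart A c p v \<noteq> 0"
      using inj_from_chart[OF atlas c] linear_from_chart[OF atlas c] that
      by (metis linear_injective_0)
    then show ?thesis using met by (simp add: riemannian_metric_def G_def)
  qed
  then obtain m where m: "m > 0" "\<And>v. m * (norm v)\<^sup>2 \<le> G p v v"
    using posdef_lower_bound[OF bil[OF c(2)]] by blast
  obtain M where M: "M > 0" "\<And>v. G p v v \<le> M * (norm v)\<^sup>2"
    using bilinear_upper_bound[OF bil[OF c(2)]] by blast
  \<comment> \<open>The total deviation of the Gram matrix entries from those at \<open>p\<close>;
    it dominates the change of the quadratic form on unit vectors.\<close>
  define E where "E q = (\<Sum>(i,j)\<in>Basis\<times>Basis. \<bar>G q i j - G p i j\<bar>)" for q
  have chart: "open (fst c)" "continuous_on (fst c) (snd c)"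
    using atlas_chart[OF atlas c(1)] by (auto simp: is_chart_def homeomorphism_def)
  have "continuous_on (fst c) (\<lambda>q. G q u v)" for u v
  proof -
    have "C_k_on 0 (\<lambda>y. let p = chart_inv c y in g p (from_chart A c p u) (from_chart A c p v))
        (snd c ` fst c)"
      using met c(1) unfolding riemannian_metric_def smooth_on_def by blast
    then have "continuous_on (snd c ` fst c) (\<lambda>y. G (chart_inv c y) u v)"
      by (simp add: G_def Let_def)
    then have "continuous_on (fst c) (\<lambda>q. G (chart_inv c (snd c q)) u v)"
      using chart(2) by (rule continuous_on_compose2) auto
    then show ?thesis
      by (simp add: chart_inv_chart[OF atlas_chart[OF atlas c(1)]] cong: continuous_on_cong)
  qed
  then have "continuous_on (fst c) E"
    unfolding E_def case_prod_unfold by (intro continuous_intros)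
  \<comment> \<open>A deviation below m/2 leaves half of the lower bound m at \<open>p\<close> and
    raises the upper bound M to at most M + m/2.\<close>
  then have W: "open (E -` {..<m/2} \<inter> fst c)" (is "open ?W")
    using continuous_on_open_vimage[OF chart(1), of E] by simp
  \<comment> \<open>Both forms are expanded over pairs of basis vectors, and each coordinate of u is
    at most its norm.\<close>
  have pert: "\<bar>G q u u - G p u u\<bar> \<le> E q * (norm u)\<^sup>2" if q: "q \<in> fst c" for q u
  proof -
    have ex: "G q u u = (\<Sum>(i,j)\<in>Basis\<times>Basis. (u \<bullet> i) * (u \<bullet> j) * G q i j)" if q: "q \<in> fst c" for q
    proof -
      have "G q u u = G q (\<Sum>i\<in>Basis. (u \<bullet> i) *\<^sub>R i) (\<Sum>i\<in>Basis. (u \<bullet> i) *\<^sub>R i)"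
        by (simp add: euclidean_representation)
      also have "\<dots> = (\<Sum>(i,j)\<in>Basis\<times>Basis. G q ((u \<bullet> i) *\<^sub>R i) ((u \<bullet> j) *\<^sub>R j))"
        by (rule bilinear_sum[OF bil[OF q]])
      also have "\<dots> = (\<Sum>(i,j)\<in>Basis\<times>Basis. (u \<bullet> i) * (u \<bullet> j) * G q i j)"
        by (rule sum.cong) (auto simp: bilinear_lmul[OF bil[OF q]] bilinear_rmul[OF bil[OF q]])
      finally show ?thesis .
    qed
    have "\<bar>G q u u - G p u u\<bar> = \<bar>\<Sum>(i,j)\<in>Basis\<times>Basis. (u \<bullet> i) * (u \<bullet> j) * (G q i j - G p i j)\<bar>"
      unfolding ex[OF q] ex[OF c(2)] sum_subtractf[symmetric]
      by (simp add: case_prod_unfold right_diff_distrib)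
    also have "\<dots> \<le> (\<Sum>(i,j)\<in>Basis\<times>Basis. \<bar>(u \<bullet> i) * (u \<bullet> j) * (G q i j - G p i j)\<bar>)"
      unfolding case_prod_unfold by (rule sum_abs)
    also have "\<dots> \<le> (\<Sum>(i,j)\<in>Basis\<times>Basis. (norm u)\<^sup>2 * \<bar>G q i j - G p i j\<bar>)"
    proof (rule sum_mono, clarsimp simp: abs_mult)
      fix i j :: 'e assume "i \<in> Basis" "j \<in> Basis"
      then have "\<bar>u \<bullet> i\<bar> * \<bar>u \<bullet> j\<bar> \<le> norm u * norm u"
        by (intro mult_mono) (auto simp: Basis_le_norm)
      then show "\<bar>u \<bullet> i\<bar> * \<bar>u \<bullet> j\<bar> * \<bar>G q i j - G p i j\<bar> \<le> (norm u)\<^sup>2 * \<bar>G q i j - G p i j\<bar>"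
        by (intro mult_right_mono) (auto simp: power2_eq_square)
    qed
    also have "\<dots> = E q * (norm u)\<^sup>2"
      unfolding E_def by (simp add: case_prod_unfold sum_distrib_left mult.commute)
    finally show ?thesis .
  qed
  have "sqrt (m/2) * norm u \<le> vec_norm g (q, from_chart A c q u) \<and>
      vec_norm g (q, from_chart A c q u) \<le> sqrt (M + m/2) * norm u" if q: "q \<in> ?W" for q u
  proof -
    have "E q * (norm u)\<^sup>2 \<le> m/2 * (norm u)\<^sup>2"
      using q by (intro mult_right_mono) auto
    then have "m/2 * (norm u)\<^sup>2 \<le> G q u u" "G q u u \<le> (M + m/2) * (norm u)\<^sup>2"
      using pert[of q u] m(2)[of u] M(2)[of u] q by (auto simp: algebra_simps abs_le_iff)
    then have "sqrt (m/2 * (norm u)\<^sup>2) \<le> sqrt (G q u u)"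
       "sqrt (G q u u) \<le> sqrt ((M + m/2) * (norm u)\<^sup>2)"
      using real_sqrt_le_iff by blast+
    then show ?thesis
      by (simp only: vec_norm_def G_def real_sqrt_mult real_sqrt_abs abs_norm_cancel prod.case)
  qed
  moreover have "p \<in> ?W" using c m(1) by (simp add: E_def case_prod_unfold)
  moreover have "sqrt (m/2) > 0" "sqrt (M + m/2) > 0" using m(1) M(1) by auto
  ultimately show ?thesis using W
    by (intro exI[of _ ?W] exI[of _ "sqrt (m/2)"] exI[of _ "sqrt (M + m/2)"]) auto
qed

section \<open>Uniform angle between the subbundles\<close>

text \<open>The fibrewise splitting condition of \<open>hyperbolic_set\<close>, isolated so that it
  can be moved into chart coordinates and used with the two subspaces exchanged.\<close>

definition complementary :: "'e::euclidean_space set \<Rightarrow> 'e set \<Rightarrow> bool" where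
  "complementary V W \<longleftrightarrow> subspace V \<and> subspace W \<and> V \<inter> W = {0} \<and> (\<forall>w. \<exists>a\<in>V. \<exists>b\<in>W. w = a + b)"

lemma complementary_sym: "complementary V W \<Longrightarrow> complementary W V"
  unfolding complementary_def by (metis Int_commute add.commute)

lemma complementary_unique:
  assumes "complementary V W" "a \<in> V" "b \<in> W" "a' \<in> V" "b' \<in> W" "a + b = a' + b'"
  shows "a = a'"
proof -
  have "a - a' \<in> V" using assms by (auto simp: complementary_def intro: subspace_diff)
  moreover have "a - a' = b' - b" using assms(6) by (simp add: algebra_simps)
  then have "a - a' \<in> W" using assms by (auto simp: complementary_def intro: subspace_diff)
  ultimately have "a - a' \<in> {0}" using assms(1) unfolding complementary_def by blast
  then show ?thesis by simp
qed

text \<open>Uniqueness of the decomposition makes the description in \<open>proj_along\<close>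
  meaningful. Decompositions add and scale, so the map is linear, hence bounded in finite dimension,
  and \<open>Blinfun\<close> represents it faithfully.\<close>

lemma proj_along_apply:
  assumes c: "complementary (V p) (W p)" and "a \<in> V p" "b \<in> W p"
  shows "blinfun_apply (proj_along V W p) (a + b) = a"
proof -
  define P where "P w = (THE a. a \<in> V p \<and> (\<exists>b\<in>W p. w = a + b))" for w
  have P: "P (a + b) = a" if "a \<in> V p" "b \<in> W p" for a b
    unfolding P_def using complementary_unique[OF c] that by (intro the_equality) blast+
  have "linear P"
  proof (rule linearI)
    fix v w r
    obtain a b a' b' where v: "a \<in> V p" "b \<in> W p" "v = a + b" "a' \<in> V p" "b' \<in> W p" "w = a' + b'"
      using c unfolding complementary_def by metis
    have "P ((a + a') + (b + b')) = a + a'" "P (r *\<^sub>R a + r *\<^sub>R b) = r *\<^sub>R a"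
      using c v by (auto intro!: P simp: complementary_def subspace_add subspace_scale)
    then show "P (v + w) = P v + P w" "P (r *\<^sub>R v) = r *\<^sub>R P v"
      using v P by (simp_all add: algebra_simps)
  qed
  then have "bounded_linear P" by (simp add: linear_conv_bounded_linear)
  then show ?thesis
    using P[OF assms(2,3)] bounded_linear_Blinfun_apply[of P]
    unfolding proj_along_def P_def[abs_def] by simp
qed

lemma complementary_norm_bound:
  assumes "complementary V W"
  shows "\<exists>B>0. \<forall>a\<in>V. \<forall>b\<in>W. norm a \<le> B * norm (a + b)"
proof -
  \<comment> \<open>A constant family over the one-point type yields the projection for a single
    pair of subspaces. Its operator norm is the bound; one is added below for positivity.\<close>
  let ?P = "proj_along (\<lambda>_::unit. V) (\<lambda>_. W) ()"
  have "norm a \<le> (norm ?P + 1) * norm (a + b)" if "a \<in> V" "b \<in> W" for a b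
  proof -
    have "norm a \<le> norm ?P * norm (a + b)"
      using norm_blinfun[of ?P "a + b"] proj_along_apply[of "\<lambda>_. V" "()" "\<lambda>_. W" a b] assms that
      by simp
    then show ?thesis by (simp add: distrib_right add_increasing2)
  qed
  moreover have "norm ?P + 1 > 0" by (simp add: add_nonneg_pos)
  ultimately show ?thesis by blast
qed

section \<open>Frames and their stability under small perturbations\<close>

lemma independent_coeff_bound:
  fixes e :: "nat \<Rightarrow> 'e::euclidean_space"
  assumes "inj_on e {..<k}" "independent (e ` {..<k})"
  shows "\<exists>L>0. \<forall>c. (\<Sum>i<k. \<bar>c i\<bar>) \<le> L * norm (\<Sum>i<k. c i *\<^sub>R e i)"
proof -
  \<comment> \<open>Dual functionals, which read off the coefficients with respect to the frame; the
    sum of their norm bounds controls all coefficients together.\<close>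
  have "\<exists>h. linear h \<and> (\<forall>j<k. h (e j) = (if j = i then 1 else 0::real))" for i
  proof -
    obtain h where h: "linear h"
      "\<forall>y\<in>e ` {..<k}. h y = (if y = e i \<and> i < k then 1 else 0::real)"
      using linear_independent_extend[OF assms(2), of "\<lambda>y. if y = e i \<and> i < k then 1 else 0"] by metis
    then have "\<forall>j<k. h (e j) = (if j = i then 1 else 0)"
      using inj_onD[OF assms(1)] by auto
    then show ?thesis using h(1) by blast
  qed
  then obtain h where h: "\<And>i. linear (h i)" "\<And>i j. j < k \<Longrightarrow> h i (e j) = (if j = i then 1 else 0::real)"
    by metis
  have "\<exists>B>0. \<forall>v. \<bar>h i v\<bar> \<le> B * norm v" for i
    using linear_bounded_pos[OF h(1)[of i]] by (metis real_norm_def)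
  then obtain B where B: "\<And>i. B i > 0" "\<And>i v. \<bar>h i v\<bar> \<le> B i * norm v"
    by metis
  have "(\<Sum>i<k. \<bar>c i\<bar>) \<le> ((\<Sum>i<k. B i) + 1) * norm (\<Sum>i<k. c i *\<^sub>R e i)" (is "_ \<le> _ * norm ?v") for c
  proof -
    have "c i = h i ?v" if "i < k" for i
    proof -
      have "h i ?v = (\<Sum>j<k. if j = i then c j else 0)"
        unfolding linear_sum[OF h(1)] linear_cmul[OF h(1)] by (rule sum.cong) (simp_all add: h(2))
      then show ?thesis using that by simp
    qed
    then have "(\<Sum>i<k. \<bar>c i\<bar>) \<le> (\<Sum>i<k. B i * norm ?v)"
      by (intro sum_mono) (metis B(2) lessThan_iff)
    also have "\<dots> \<le> ((\<Sum>i<k. B i) + 1) * norm ?v"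
      by (simp add: sum_distrib_right distrib_right)
    finally show ?thesis .
  qed
  moreover have "(\<Sum>i<k. B i) + 1 > 0"
    by (rule add_nonneg_pos) (auto intro: sum_nonneg less_imp_le B(1))
  ultimately show ?thesis by blast
qed

lemma span_frame:
  fixes e :: "nat \<Rightarrow> 'e::real_vector"
  assumes "inj_on e {..<k}" "a \<in> span (e ` {..<k})"
  shows "\<exists>c. a = (\<Sum>i<k. c i *\<^sub>R e i)"
proof -
  obtain u where "a = (\<Sum>v\<in>e ` {..<k}. u v *\<^sub>R v)"
    using assms(2) by (auto simp: span_finite)
  also have "\<dots> = (\<Sum>i<k. u (e i) *\<^sub>R e i)"
    by (simp add: sum.reindex[OF assms(1)])
  finally show ?thesis by (rule exI[of _ "\<lambda>i. u (e i)"])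
qed

lemma eventually_frame_close:
  fixes e :: "nat \<Rightarrow> 'm::topological_space \<Rightarrow> 'e::real_normed_vector"
  assumes "\<And>i. i < k \<Longrightarrow> continuous_on S (e i)" "p \<in> S" "\<epsilon> > 0"
  shows "\<exists>W. open W \<and> p \<in> W \<and> (\<forall>q\<in>S \<inter> W. \<forall>i<k. norm (e i q - e i p) < \<epsilon>)"
proof -
  have "\<exists>W. open W \<and> p \<in> W \<and> (\<forall>q\<in>S \<inter> W. norm (e i q - e i p) < \<epsilon>)" if i: "i < k" for i
  proof -
    have "open (ball (e i p) \<epsilon>)" "e i p \<in> ball (e i p) \<epsilon>" using assms(3) by auto
    then obtain W where "open W" "p \<in> W" "\<forall>q\<in>S. q \<in> W \<longrightarrow> e i q \<in> ball (e i p) \<epsilon>"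
      using assms(1)[OF i] assms(2) unfolding continuous_on_topological by metis
    then show ?thesis
      by (intro exI[of _ W]) (auto simp: dist_norm norm_minus_commute)
  qed
  then obtain W where W: "\<And>i. i < k \<Longrightarrow> open (W i) \<and> p \<in> W i \<and> (\<forall>q\<in>S \<inter> W i. norm (e i q - e i p) < \<epsilon>)"
    by metis
  show ?thesis
    by (rule exI[of _ "\<Inter>i<k. W i"]) (use W in auto)
qed

text \<open>A vector at \<open>q\<close> is compared with the vector at \<open>p\<close> having the
  same coefficients. At \<open>p\<close> the coefficients are controlled by the norm of the sum of
  the two components, and moving the frames slightly changes that sum by a small multiple of the
  coefficients, which can be absorbed.\<close>

lemma frames_angle_bound:
  fixes e e' :: "nat \<Rightarrow> 'm::topological_space \<Rightarrow> 'e::euclidean_space"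
  assumes cont: "\<And>i. i < k \<Longrightarrow> continuous_on S (e i)" "\<And>i. i < k' \<Longrightarrow> continuous_on S (e' i)"
    and inj: "\<And>q. q \<in> S \<Longrightarrow> inj_on (\<lambda>i. e i q) {..<k}" "\<And>q. q \<in> S \<Longrightarrow> inj_on (\<lambda>i. e' i q) {..<k'}"
    and p: "p \<in> S" "independent ((\<lambda>i. e i p) ` {..<k})" "independent ((\<lambda>i. e' i p) ` {..<k'})"
    and compl: "complementary (span ((\<lambda>i. e i p) ` {..<k})) (span ((\<lambda>i. e' i p) ` {..<k'}))"
  shows "\<exists>W B. open W \<and> p \<in> W \<and> B > 0 \<and>
    (\<forall>q\<in>S \<inter> W. \<forall>a\<in>span ((\<lambda>i. e i q) ` {..<k}). \<forall>b\<in>span ((\<lambda>i. e' i q) ` {..<k'}).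
      norm a \<le> B * norm (a + b))"
proof -
  obtain L1 where L1: "L1 > 0" "\<And>c. (\<Sum>i<k. \<bar>c i\<bar>) \<le> L1 * norm (\<Sum>i<k. c i *\<^sub>R e i p)"
    using independent_coeff_bound[OF inj(1)[OF p(1)] p(2)] by blast
  obtain L2 where L2: "L2 > 0" "\<And>c. (\<Sum>i<k'. \<bar>c i\<bar>) \<le> L2 * norm (\<Sum>i<k'. c i *\<^sub>R e' i p)"
    using independent_coeff_bound[OF inj(2)[OF p(1)] p(3)] by blast
  obtain B1 where B1: "B1 > 0" "\<And>a b. a \<in> span ((\<lambda>i. e i p) ` {..<k}) \<Longrightarrow>
      b \<in> span ((\<lambda>i. e' i p) ` {..<k'}) \<Longrightarrow> norm a \<le> B1 * norm (a + b)"
    using complementary_norm_bound[OF compl] by blast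
  obtain B2 where B2: "B2 > 0" "\<And>a b. a \<in> span ((\<lambda>i. e i p) ` {..<k}) \<Longrightarrow>
      b \<in> span ((\<lambda>i. e' i p) ` {..<k'}) \<Longrightarrow> norm b \<le> B2 * norm (a + b)"
    using complementary_norm_bound[OF complementary_sym[OF compl]] by (metis add.commute)
  define L where "L = L1 * B1 + L2 * B2"
  have L: "L > 0" using L1(1) L2(1) B1(1) B2(1) by (simp add: L_def add_pos_pos)
  \<comment> \<open>Chosen so that L times \<epsilon> is 1/2: the error term then takes up only half
    of the left-hand side.\<close>
  define \<epsilon> where "\<epsilon> = 1 / (2 * L)"
  have \<epsilon>: "\<epsilon> > 0" using L by (simp add: \<epsilon>_def)
  obtain W where W: "open W" "p \<in> W" "\<And>q i. q \<in> S \<inter> W \<Longrightarrow> i < k \<Longrightarrow> norm (e i q - e i p) < \<epsilon>"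
    using eventually_frame_close[of k S e, OF cont(1) p(1) \<epsilon>] by blast
  obtain W' where W': "open W'" "p \<in> W'" "\<And>q i. q \<in> S \<inter> W' \<Longrightarrow> i < k' \<Longrightarrow> norm (e' i q - e' i p) < \<epsilon>"
    using eventually_frame_close[of k' S e', OF cont(2) p(1) \<epsilon>] by blast
  \<comment> \<open>A common bound for the norms of all frame vectors \<open>e i q\<close> with
    \<open>q\<close> close to \<open>p\<close>; it turns a coefficient bound into a bound on
    a.\<close>
  define M where "M = (\<Sum>i<k. norm (e i p)) + \<epsilon>"
  have M: "M > 0" unfolding M_def using \<epsilon> by (intro add_nonneg_pos sum_nonneg) auto
  have "norm a \<le> (M * (2 * L)) * norm (a + b)"
    if q: "q \<in> S \<inter> (W \<inter> W')" and ab: "a \<in> span ((\<lambda>i. e i q) ` {..<k})" "b \<in> span ((\<lambda>i. e' i q) ` {..<k'})"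
    for q a b
  proof -
    obtain c where c: "a = (\<Sum>i<k. c i *\<^sub>R e i q)" using span_frame[OF inj(1) ab(1)] q by blast
    obtain d where d: "b = (\<Sum>i<k'. d i *\<^sub>R e' i q)" using span_frame[OF inj(2) ab(2)] q by blast
    \<comment> \<open>The coefficients found at \<open>q\<close>, placed on the frame at
      \<open>p\<close>.\<close>
    define a0 where "a0 = (\<Sum>i<k. c i *\<^sub>R e i p)"
    define b0 where "b0 = (\<Sum>i<k'. d i *\<^sub>R e' i p)"
    have ab0: "a0 \<in> span ((\<lambda>i. e i p) ` {..<k})" "b0 \<in> span ((\<lambda>i. e' i p) ` {..<k'})"
      unfolding a0_def b0_def by (intro span_sum span_scale span_base; simp)+
    define s where "s = (\<Sum>i<k. \<bar>c i\<bar>)"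
    define t where "t = (\<Sum>i<k'. \<bar>d i\<bar>)"
    have "s \<le> L1 * norm a0" "t \<le> L2 * norm b0"
      unfolding s_def t_def a0_def b0_def by (rule L1 L2)+
    moreover have "L1 * norm a0 \<le> L1 * (B1 * norm (a0 + b0))" "L2 * norm b0 \<le> L2 * (B2 * norm (a0 + b0))"
      using L1(1) L2(1) B1(2)[OF ab0] B2(2)[OF ab0] by (auto intro!: mult_left_mono)
    ultimately have st: "s + t \<le> L * norm (a0 + b0)"
      by (simp add: L_def algebra_simps)
    have le: "norm (r *\<^sub>R v) \<le> \<bar>r\<bar> * \<epsilon>" if "norm v < \<epsilon>" for r and v :: 'e
      using that by (simp add: mult_left_mono)
    have "norm (a - a0) \<le> (\<Sum>i<k. \<bar>c i\<bar> * \<epsilon>)"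
      unfolding c a0_def sum_subtractf[symmetric] scaleR_diff_right[symmetric]
      by (rule sum_norm_le) (use W(3) q in \<open>auto intro!: le simp del: norm_scaleR\<close>)
    moreover have "norm (b - b0) \<le> (\<Sum>i<k'. \<bar>d i\<bar> * \<epsilon>)"
      unfolding d b0_def sum_subtractf[symmetric] scaleR_diff_right[symmetric]
      by (rule sum_norm_le) (use W'(3) q in \<open>auto intro!: le simp del: norm_scaleR\<close>)
    moreover have "norm (a0 + b0) \<le> norm (a + b) + norm (a - a0) + norm (b - b0)"
      by norm
    ultimately have "norm (a0 + b0) \<le> norm (a + b) + (s + t) * \<epsilon>"
      by (simp add: s_def t_def sum_distrib_right distrib_right)
    \<comment> \<open>Together with \<open>st\<close> this is an inequality with half of s + t on
      the right, which is moved to the left.\<close>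
    from mult_left_mono[OF this, of L] L
    have "L * norm (a0 + b0) \<le> L * norm (a + b) + (s + t) * (L * \<epsilon>)"
      by (simp add: algebra_simps)
    moreover have "L * \<epsilon> = 1/2" using L by (simp add: \<epsilon>_def)
    ultimately have st': "s + t \<le> 2 * L * norm (a + b)" using st by (simp add: field_simps)
    have "norm a \<le> (\<Sum>i<k. \<bar>c i\<bar> * M)"
      unfolding c
    proof (rule sum_norm_le)
      fix i assume i: "i \<in> {..<k}"
      have "norm (e i q) \<le> norm (e i p) + norm (e i q - e i p)" by norm
      also have "norm (e i p) \<le> (\<Sum>i<k. norm (e i p))"
        using i by (intro member_le_sum) auto
      also have "norm (e i q - e i p) \<le> \<epsilon>" using W(3) q i by (auto intro: less_imp_le)
      finally show "norm (c i *\<^sub>R e i q) \<le> \<bar>c i\<bar> * M"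
        by (simp add: M_def mult_left_mono)
    qed
    also have "\<dots> = M * s" by (simp add: s_def sum_distrib_left mult.commute)
    also have "\<dots> \<le> M * (2 * L * norm (a + b))"
    proof (rule mult_left_mono)
      have "0 \<le> t" by (simp add: t_def sum_nonneg)
      then show "s \<le> 2 * L * norm (a + b)" using st' by linarith
    qed (use M in simp)
    finally show ?thesis by (simp add: mult.assoc)
  qed
  then show ?thesis
    using W W' M L by (intro exI[of _ "W \<inter> W'"] exI[of _ "M * (2 * L)"]) auto
qed

section \<open>The uniform angle between two subbundles over a compact set\<close>

lemma complementary_linear_preimage:
  assumes "linear h" "inj h" "complementary (h ` V) (h ` W)" "subspace V" "subspace W"
  shows "complementary V W"
  unfolding complementary_def
proof (intro conjI allI assms)
  show "V \<inter> W = {0}"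
    using assms subspace_0[of V] subspace_0[of W] unfolding complementary_def
    by (metis image_Int image_is_empty inj_image_eq_iff linear_0 image_insert image_empty)
  fix w
  obtain a b where "a \<in> V" "b \<in> W" "h w = h a + h b"
    using assms(3) unfolding complementary_def by (metis imageE)
  then have "w = a + b"
    using assms(1,2) by (metis injD linear_add)
  then show "\<exists>a\<in>V. \<exists>b\<in>W. w = a + b" using \<open>a \<in> V\<close> \<open>b \<in> W\<close> by blast
qed

text \<open>The frames of the two subbundles may live in different charts. The second is moved into
  the chart of the first, where the perturbation bound for frames applies in the coordinate norm;
  norm equivalence near \<open>p\<close> then gives the Riemannian statement.\<close>

lemma subbundle_angle_local:
  fixes A :: "('m::{t2_space,second_countable_topology}, 'e::euclidean_space) chart set"
  assumes atlas: "smooth_atlas A" and met: "riemannian_metric A g"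
    and V: "continuous_subbundle A K V" and V': "continuous_subbundle A K V'"
    and compl: "\<And>q. q \<in> K \<Longrightarrow> complementary (V q) (V' q)"
    and p: "p \<in> K"
  shows "\<exists>W B. open W \<and> p \<in> W \<and> B > 0 \<and> (\<forall>q\<in>K \<inter> W. \<forall>a\<in>V q. \<forall>b\<in>V' q.
      vec_norm g (q, a) \<le> B * vec_norm g (q, a + b))"
proof -
  obtain c N k e where c: "c \<in> A" "open N" "p \<in> N" "N \<subseteq> fst c"
    and e: "\<forall>i<k. continuous_on (K \<inter> N) (e i)"
      "\<forall>q\<in>K \<inter> N. inj_on (\<lambda>i. e i q) {..<k::nat} \<and> independent ((\<lambda>i. e i q) ` {..<k}) \<and>
              V q = from_chart A c q ` span ((\<lambda>i. e i q) ` {..<k})"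
    using bspec[OF V[unfolded continuous_subbundle_def] p]
    by (elim bexE exE conjE) (rule that)
  obtain c' N' k' e' where c': "c' \<in> A" "open N'" "p \<in> N'" "N' \<subseteq> fst c'"
    and e': "\<forall>i<k'. continuous_on (K \<inter> N') (e' i)"
      "\<forall>q\<in>K \<inter> N'. inj_on (\<lambda>i. e' i q) {..<k'::nat} \<and> independent ((\<lambda>i. e' i q) ` {..<k'}) \<and>
              V' q = from_chart A c' q ` span ((\<lambda>i. e' i q) ` {..<k'})"
    using bspec[OF V'[unfolded continuous_subbundle_def] p]
    by (elim bexE exE conjE) (rule that)
  note e = e(1)[rule_format] e(2)[rule_format] and e' = e'(1)[rule_format] e'(2)[rule_format]
  define S where "S = K \<inter> (N \<inter> N')"
  \<comment> \<open>The frame of \<open>V'\<close> rewritten in the coordinates of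
    \<open>c\<close>.\<close>
  define d where "d i q = transition c' c q (e' i q)" for i q
  have S: "q \<in> K" "q \<in> N" "q \<in> N'" "q \<in> fst c" "q \<in> fst c'" if "q \<in> S" for q
    using that c c' by (auto simp: S_def)
  have tr: "linear (transition c' c q)" "inj (transition c' c q)" if "q \<in> S" for q
    using linear_transition[OF atlas c'(1) c(1)] inj_transition[OF atlas c'(1) c(1)] S[OF that]
    by blast+
  have dimg: "(\<lambda>i. d i q) ` {..<k'} = transition c' c q ` (\<lambda>i. e' i q) ` {..<k'}" for q
    by (simp add: d_def image_image)
  have dcont: "continuous_on S (d i)" if "i < k'" for i
    unfolding d_def[abs_def]
  proof (rule continuous_on_transition[OF atlas c'(1) c(1)])
    show "continuous_on S (e' i)"
      using e'(1)[OF that] by (rule continuous_on_subset) (auto simp: S_def)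
  qed (use S in auto)
  have dframe: "inj_on (\<lambda>i. d i q) {..<k'}" "independent ((\<lambda>i. d i q) ` {..<k'})"
    "V' q = from_chart A c q ` span ((\<lambda>i. d i q) ` {..<k'})" if "q \<in> S" for q
  proof -
    have q: "q \<in> K \<inter> N'" using S that by blast
    show "inj_on (\<lambda>i. d i q) {..<k'}"
      using e'(2)[OF q] tr(2)[OF that] unfolding d_def inj_on_def by blast
    show "independent ((\<lambda>i. d i q) ` {..<k'})"
      unfolding dimg using e'(2)[OF q] tr[OF that]
      by (intro linear_independent_injective_image) (auto intro: inj_on_subset)
    show "V' q = from_chart A c q ` span ((\<lambda>i. d i q) ` {..<k'})"
      unfolding dimg linear_span_image[OF tr(1)[OF that]]
      using e'(2)[OF q] from_chart_transition[OF atlas c'(1) c(1)] S[OF that]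
      by (simp add: image_image[of "from_chart A c q"])
  qed
  have eframe: "inj_on (\<lambda>i. e i q) {..<k}" "independent ((\<lambda>i. e i q) ` {..<k})"
    "V q = from_chart A c q ` span ((\<lambda>i. e i q) ` {..<k})" if "q \<in> S" for q
    using e(2)[of q] S[OF that] by auto
  have econt: "continuous_on S (e i)" if "i < k" for i
    using e(1)[OF that] by (rule continuous_on_subset) (auto simp: S_def)
  have pS: "p \<in> S" using p c c' by (simp add: S_def)
  \<comment> \<open>The splitting of the fibre at \<open>p\<close> is pulled back to coordinates
    through the injective linear map \<open>from_chart A c p\<close>.\<close>
  have "complementary (span ((\<lambda>i. e i p) ` {..<k})) (span ((\<lambda>i. d i p) ` {..<k'}))"
  proof (rule complementary_linear_preimage)
    show "linear (from_chart A c p)" "inj (from_chart A c p)"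
      using linear_from_chart[OF atlas c(1)] inj_from_chart[OF atlas c(1)] S[OF pS] by auto
    show "complementary (from_chart A c p ` span ((\<lambda>i. e i p) ` {..<k}))
        (from_chart A c p ` span ((\<lambda>i. d i p) ` {..<k'}))"
      using compl[OF p] eframe(3)[OF pS] dframe(3)[OF pS] by simp
  qed auto
  from frames_angle_bound[where e = e and e' = d and S = S and k = k and k' = k' and p = p,
      OF econt dcont eframe(1) dframe(1) pS eframe(2)[OF pS] dframe(2)[OF pS] this]
  obtain W1 B where W1: "open W1" "p \<in> W1" "B > 0" "\<And>q a b. q \<in> S \<inter> W1 \<Longrightarrow>
      a \<in> span ((\<lambda>i. e i q) ` {..<k}) \<Longrightarrow> b \<in> span ((\<lambda>i. d i q) ` {..<k'}) \<Longrightarrow>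
      norm a \<le> B * norm (a + b)" by blast
  obtain W2 m M where W2: "open W2" "p \<in> W2" "m > 0" "M > 0"
    "\<And>q u. q \<in> W2 \<Longrightarrow> m * norm u \<le> vec_norm g (q, from_chart A c q u)"
    "\<And>q u. q \<in> W2 \<Longrightarrow> vec_norm g (q, from_chart A c q u) \<le> M * norm u"
    using chart_norm_equiv[OF atlas met c(1) S(4)[OF pS]] by blast
  \<comment> \<open>M and 1/m pay for passing from the Riemannian norm to the coordinate norm and
    back; B is the angle bound in coordinates.\<close>
  have "vec_norm g (q, a) \<le> (M * B / m) * vec_norm g (q, a + b)"
    if q: "q \<in> K \<inter> (N \<inter> N' \<inter> W1 \<inter> W2)" and ab: "a \<in> V q" "b \<in> V' q" for q a b
  proof -
    have qS: "q \<in> S" using q by (auto simp: S_def)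
    obtain a' where a': "a' \<in> span ((\<lambda>i. e i q) ` {..<k})" "a = from_chart A c q a'"
      using ab(1) eframe(3)[OF qS] by blast
    obtain b' where b': "b' \<in> span ((\<lambda>i. d i q) ` {..<k'})" "b = from_chart A c q b'"
      using ab(2) dframe(3)[OF qS] by blast
    have s: "a + b = from_chart A c q (a' + b')"
      using a' b' linear_from_chart[OF atlas c(1) S(4)[OF qS]] by (simp add: linear_add)
    have "vec_norm g (q, a) \<le> M * norm a'" using W2(6) q a' by blast
    also have "\<dots> \<le> M * (B * norm (a' + b'))"
      using W1(4)[OF _ a'(1) b'(1)] q qS W2(4) by (intro mult_left_mono) auto
    also have "norm (a' + b') \<le> vec_norm g (q, a + b) / m"
      using W2(5)[of q "a' + b'"] q W2(3) s by (simp add: field_simps)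
    finally show ?thesis using W2(4) W1(3) by (simp add: mult_left_mono)
  qed
  then show ?thesis
    using W1 W2 c c' by (intro exI[of _ "N \<inter> N' \<inter> W1 \<inter> W2"] exI[of _ "M * B / m"]) auto
qed

text \<open>Finitely many of the local neighbourhoods cover \<open>K\<close>, and the sum of their
  positive constants dominates each of them.\<close>

lemma subbundle_angle:
  fixes A :: "('m::{t2_space,second_countable_topology}, 'e::euclidean_space) chart set"
  assumes "smooth_atlas A" "riemannian_metric A g" "compact K"
    and "continuous_subbundle A K V" "continuous_subbundle A K V'"
    and "\<And>q. q \<in> K \<Longrightarrow> complementary (V q) (V' q)"
  shows "\<exists>B>0. \<forall>q\<in>K. \<forall>a\<in>V q. \<forall>b\<in>V' q. vec_norm g (q, a) \<le> B * vec_norm g (q, a + b)"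
proof -
  have "\<forall>p\<in>K. \<exists>W B. open W \<and> p \<in> W \<and> B > 0 \<and> (\<forall>q\<in>K \<inter> W. \<forall>a\<in>V q. \<forall>b\<in>V' q.
      vec_norm g (q, a) \<le> B * vec_norm g (q, a + b))"
    using subbundle_angle_local[OF assms(1,2,4,5,6)] by blast
  then obtain W B where W: "\<And>p. p \<in> K \<Longrightarrow> open (W p) \<and> p \<in> W p \<and> B p > 0"
    and B: "\<And>p q a b. p \<in> K \<Longrightarrow> q \<in> K \<Longrightarrow> q \<in> W p \<Longrightarrow> a \<in> V q \<Longrightarrow> b \<in> V' q \<Longrightarrow>
      vec_norm g (q, a) \<le> B p * vec_norm g (q, a + b)"
    by (metis IntI)
  obtain F where F: "F \<subseteq> K" "finite F" "K \<subseteq> (\<Union>p\<in>F. W p)"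
    using compactE_image[OF assms(3), of K W] W by blast
  have pos: "vec_norm g (q, v) \<ge> 0" for q v
    using assms(2) unfolding riemannian_metric_def vec_norm_def
    by (cases "v = 0") (auto simp: bilinear_lzero less_imp_le)
  have "vec_norm g (q, a) \<le> ((\<Sum>p\<in>F. B p) + 1) * vec_norm g (q, a + b)"
    if q: "q \<in> K" and ab: "a \<in> V q" "b \<in> V' q" for q a b
  proof -
    obtain p where p: "p \<in> F" "q \<in> W p" using F(3) q by blast
    have "B p \<le> (\<Sum>p\<in>F. B p)"
      using p F W by (intro member_le_sum) (auto intro: less_imp_le)
    then have "B p * vec_norm g (q, a + b) \<le> ((\<Sum>p\<in>F. B p) + 1) * vec_norm g (q, a + b)"
      using pos by (intro mult_right_mono) auto
    then show ?thesis using B[of p q a b] p F q ab by force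
  qed
  moreover have "(\<Sum>p\<in>F. B p) + 1 > 0"
    using W F by (intro add_nonneg_pos sum_nonneg) (auto intro: less_imp_le)
  ultimately show ?thesis by blast
qed

section \<open>Exponential dichotomies on a fixed space\<close>

text \<open>The value type is arbitrary: the lemma serves for vectors, covectors and truth
  values.\<close>

lemma int_constant:
  fixes d :: "int \<Rightarrow> 'b"
  assumes "\<And>n. d (n + 1) = d n"
  shows "d n = d 0"
proof (induction n rule: int_induct[where k = 0])
  case (step2 i)
  then show ?case using assms[of "i - 1"] by simp
qed (use assms in auto)

text \<open>The picture after all fibres are identified: \<open>N n\<close> is the norm of the fibre
  at time n, while the vectors and the projections \<open>P\<close>, \<open>Q\<close> no longer
  depend on time. The constant in \<open>N_equiv\<close> may depend on n, so uniform boundedness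
  along the orbit has to be measured with \<open>N n\<close> itself.\<close>

locale dichotomy =
  fixes N :: "int \<Rightarrow> 'e::euclidean_space \<Rightarrow> real" and P Q :: "'e \<Rightarrow>\<^sub>L 'e" and C r B :: real
  assumes N_triangle: "N n (v + w) \<le> N n v + N n w"
    and N_uminus: "N n (- v) = N n v"
    and N_equiv: "\<exists>\<kappa>>0. \<forall>v. norm v \<le> \<kappa> * N n v \<and> N n v \<le> \<kappa> * norm v"
    and P_plus_Q: "P v + Q v = v"
    and P_P: "P (P v) = P v" and Q_Q: "Q (Q v) = Q v"
    and C_pos: "C > 0" and r_pos: "r > 0" and r_less_1: "r < 1" and B_pos: "B > 0"
    and stable: "N (n + int k) (P v) \<le> C * r ^ k * N n (P v)"
    and unstable: "N n (Q v) \<le> C * r ^ k * N (n + int k) (Q v)"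
    and P_bound: "N n (P v) \<le> B * N n v"
    and Q_bound: "N n (Q v) \<le> B * N n v"
begin

definition bdd_vecs :: "(int \<Rightarrow> 'e) \<Rightarrow> bool" where
  "bdd_vecs X \<longleftrightarrow> (\<exists>b. \<forall>n. N n (X n) \<le> b)"

text \<open>Uniform boundedness in the dual norms, phrased pointwise so that no supremum has to be
  handled.\<close>

definition bdd_covecs :: "(int \<Rightarrow> 'e \<Rightarrow>\<^sub>L real) \<Rightarrow> bool" where
  "bdd_covecs \<eta> \<longleftrightarrow> (\<exists>b. \<forall>n v. \<bar>\<eta> n v\<bar> \<le> b * N n v)"

lemma N_nonneg: "N n v \<ge> 0"
proof -
  obtain \<kappa> where "\<kappa> > 0" "norm v \<le> \<kappa> * N n v" using N_equiv by blast
  then show ?thesis by (metis norm_ge_zero order_trans zero_le_mult_iff not_le less_le)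
qed

lemma N_zero: "N n 0 = 0"
proof -
  obtain \<kappa> where "N n 0 \<le> \<kappa> * norm (0::'e)" using N_equiv by blast
  then show ?thesis using N_nonneg[of n 0] by simp
qed

lemma N_eq_0_imp:
  assumes "N n v \<le> 0"
  shows "v = 0"
proof -
  obtain \<kappa> where "norm v \<le> \<kappa> * N n v" using N_equiv by blast
  then show ?thesis using N_nonneg[of n v] assms by simp
qed

lemma N_diff: "N n (v - w) \<le> N n v + N n w"
  using N_triangle[of n v "- w"] by (simp add: N_uminus)

lemma bdd_vecsE:
  assumes "bdd_vecs X"
  obtains b where "b \<ge> 0" "\<And>n. N n (X n) \<le> b"
  using assms N_nonneg unfolding bdd_vecs_def by (metis order_trans)

lemma bdd_covecsE:
  assumes "bdd_covecs \<eta>"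
  obtains b where "b \<ge> 0" "\<And>n v. \<bar>\<eta> n v\<bar> \<le> b * N n v"
proof -
  obtain b where b: "\<And>n v. \<bar>\<eta> n v\<bar> \<le> b * N n v"
    using assms unfolding bdd_covecs_def by blast
  have "\<bar>\<eta> n v\<bar> \<le> \<bar>b\<bar> * N n v" for n v
    using b[of n v] mult_right_mono[OF abs_ge_self[of b] N_nonneg[of n v]] by linarith
  then show ?thesis using that[of "\<bar>b\<bar>"] by simp
qed

lemma bdd_vecs_diff: "bdd_vecs v \<Longrightarrow> bdd_vecs w \<Longrightarrow> bdd_vecs (\<lambda>n. v n - w n)"
  unfolding bdd_vecs_def by (meson N_diff add_mono order_trans)

lemma bdd_covecs_diff:
  assumes "bdd_covecs \<eta>" "bdd_covecs \<zeta>"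
  shows "bdd_covecs (\<lambda>n. \<eta> n - \<zeta> n)"
proof -
  obtain b where b: "\<And>n v. \<bar>\<eta> n v\<bar> \<le> b * N n v" using assms(1) bdd_covecsE by blast
  obtain b' where b': "\<And>n v. \<bar>\<zeta> n v\<bar> \<le> b' * N n v" using assms(2) bdd_covecsE by blast
  have "\<bar>(\<eta> n - \<zeta> n) v\<bar> \<le> (b + b') * N n v" for n v
    using b[of n v] b'[of n v] by (simp add: blinfun.diff_left distrib_right)
  then show ?thesis unfolding bdd_covecs_def by blast
qed

section \<open>Geometrically dominated series of vectors and covectors\<close>

lemma geometric_tendsto_0: "(\<lambda>k. c * r ^ k) \<longlonglongrightarrow> 0"
  using LIMSEQ_power_zero[of r] r_pos r_less_1 by (simp add: tendsto_mult_right_zero)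

lemma geometric_suminf: "summable (\<lambda>k. \<beta> * r ^ k)" "(\<Sum>k. \<beta> * r ^ k) = \<beta> / (1 - r)"
  using r_pos r_less_1 by (auto simp: suminf_mult suminf_geometric summable_geometric intro!: summable_mult)

lemma le_geometric_imp_le_0:
  assumes "\<And>k. a \<le> c * r ^ k"
  shows "a \<le> 0"
  using LIMSEQ_le_const[OF geometric_tendsto_0[of c]] assms by blast

lemma vec_series:
  assumes "\<And>k. N n (a k) \<le> \<beta> * r ^ k"
  shows "summable a" "N n (suminf a) \<le> \<beta> / (1 - r)"
proof -
  obtain \<kappa> where \<kappa>: "\<kappa> > 0" "\<And>v. norm v \<le> \<kappa> * N n v" "\<And>v. N n v \<le> \<kappa> * norm v"
    using N_equiv by blast
  have "norm (a k) \<le> (\<kappa> * \<beta>) * r ^ k" for k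
    using order_trans[OF \<kappa>(2)[of "a k"] mult_left_mono[OF assms[of k], of \<kappa>]] \<kappa>(1)
    by (simp add: mult.assoc)
  then show s: "summable a"
    by (intro summable_comparison_test'[OF geometric_suminf(1)[of "\<kappa> * \<beta>"]]) auto
  have fin: "N n (\<Sum>k<m. a k) \<le> (\<Sum>k<m. \<beta> * r ^ k)" for m
  proof (induction m)
    case (Suc m)
    then show ?case using N_triangle[of n "\<Sum>k<m. a k" "a m"] assms[of m] by simp
  qed (simp add: N_zero)
  have \<beta>: "\<beta> \<ge> 0" using order_trans[OF N_nonneg assms[of 0]] by simp
  \<comment> \<open>The bound for partial sums passes to the limit because \<open>N n\<close> of the
    remainder is at most \<kappa> times its ordinary norm, which tends to 0.\<close>
  have "N n (suminf a) \<le> \<beta> / (1 - r) + \<kappa> * norm (suminf a - (\<Sum>k<m. a k))" for m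
  proof -
    have "N n (suminf a) \<le> N n (\<Sum>k<m. a k) + N n (suminf a - (\<Sum>k<m. a k))"
      using N_triangle[of n "\<Sum>k<m. a k" "suminf a - (\<Sum>k<m. a k)"] by simp
    moreover have "(\<Sum>k<m. \<beta> * r ^ k) \<le> \<beta> / (1 - r)"
      unfolding geometric_suminf(2)[symmetric]
      by (rule sum_le_suminf) (use geometric_suminf(1) \<beta> r_pos in auto)
    ultimately show ?thesis using fin[of m] \<kappa>(3)[of "suminf a - (\<Sum>k<m. a k)"] by linarith
  qed
  then have "\<exists>k. \<forall>m\<ge>k. N n (suminf a) \<le> \<beta> / (1 - r) + \<kappa> * norm (suminf a - (\<Sum>k<m. a k))"
    by blast
  moreover have "(\<lambda>m. \<beta> / (1 - r) + \<kappa> * norm (suminf a - (\<Sum>k<m. a k))) \<longlonglongrightarrow>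
      \<beta> / (1 - r) + \<kappa> * norm (suminf a - suminf a)"
    by (intro tendsto_intros summable_LIMSEQ s)
  ultimately have "N n (suminf a) \<le> \<beta> / (1 - r) + \<kappa> * norm (suminf a - suminf a)"
    by (rule LIMSEQ_le_const[rotated])
  then show "N n (suminf a) \<le> \<beta> / (1 - r)" by simp
qed

lemma covec_series:
  fixes \<eta> :: "nat \<Rightarrow> 'e \<Rightarrow>\<^sub>L real"
  assumes "\<And>k v. \<bar>\<eta> k v\<bar> \<le> \<beta> * r ^ k * N n v"
  shows "summable (\<lambda>k. norm (\<eta> k))" "\<bar>(\<Sum>k. \<eta> k) v\<bar> \<le> \<beta> / (1 - r) * N n v"
proof -
  obtain \<kappa> where \<kappa>: "\<kappa> > 0" "\<And>v. N n v \<le> \<kappa> * norm v"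
    using N_equiv by blast
  \<comment> \<open>A nonzero vector has positive \<open>N n\<close>, so the hypothesis for k = 0
    forces \<beta> to be nonnegative.\<close>
  obtain e :: 'e where "e \<in> Basis" using nonempty_Basis by blast
  then have "N n e > 0" using N_eq_0_imp[of n e] nonzero_Basis not_le by blast
  moreover have "0 \<le> \<beta> * N n e" using order_trans[OF abs_ge_zero assms[of 0 e]] by simp
  ultimately have \<beta>: "\<beta> \<ge> 0" by (simp add: zero_le_mult_iff)
  have "norm (\<eta> k) \<le> (\<beta> * \<kappa>) * r ^ k" for k
  proof (rule norm_blinfun_bound)
    show "0 \<le> (\<beta> * \<kappa>) * r ^ k" using \<beta> \<kappa> r_pos by simp
    fix v
    have "\<bar>\<eta> k v\<bar> \<le> \<beta> * r ^ k * (\<kappa> * norm v)"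
      using assms[of k v] mult_left_mono[OF \<kappa>(2)[of v], of "\<beta> * r ^ k"] \<beta> r_pos
      by (auto intro: order_trans)
    then show "norm (\<eta> k v) \<le> (\<beta> * \<kappa>) * r ^ k * norm v" by (simp add: mult_ac)
  qed
  then show s: "summable (\<lambda>k. norm (\<eta> k))"
    by (intro summable_comparison_test'[OF geometric_suminf(1)[of "\<beta> * \<kappa>"]]) auto
  have le: "norm (\<eta> k v) \<le> (\<beta> * N n v) * r ^ k" for k
    using assms[of k v] by (simp add: mult_ac)
  have "(\<Sum>k. \<eta> k) v = (\<Sum>k. \<eta> k v)"
    using bounded_linear.suminf[OF blinfun.bounded_linear_left summable_norm_cancel[OF s]] by simp
  also have "\<bar>\<dots>\<bar> \<le> (\<Sum>k. (\<beta> * N n v) * r ^ k)"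
    using norm_suminf_le[OF le geometric_suminf(1)] by simp
  finally show "\<bar>(\<Sum>k. \<eta> k) v\<bar> \<le> \<beta> / (1 - r) * N n v"
    by (simp add: geometric_suminf(2))
qed

section \<open>Uniqueness and existence of bounded solutions\<close>

lemma bounded_constant_eq_0:
  assumes "\<And>n. N n d \<le> b"
  shows "d = 0"
proof -
  have C: "C * r ^ k \<ge> 0" for k using C_pos r_pos by simp
  \<comment> \<open>The stable part is estimated from the remote past: k steps of contraction lead
    from time -k to time 0.\<close>
  have "N 0 (P d) \<le> (C * B * b) * r ^ k" for k
  proof -
    have "N 0 (P d) \<le> C * r ^ k * N (- int k) (P d)" using stable[of "- int k" k] by simp
    also have "\<dots> \<le> C * r ^ k * (B * b)"
      using order_trans[OF P_bound mult_left_mono[OF assms]] B_pos C by (intro mult_left_mono) auto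
    finally show ?thesis by (simp add: mult_ac)
  qed
  then have "P d = 0" using le_geometric_imp_le_0 N_eq_0_imp by metis
  \<comment> \<open>The unstable part is estimated from the remote future, at time k.\<close>
  have "N 0 (Q d) \<le> (C * B * b) * r ^ k" for k
  proof -
    have "N 0 (Q d) \<le> C * r ^ k * N (int k) (Q d)" using unstable[of 0 _ k] by simp
    also have "\<dots> \<le> C * r ^ k * (B * b)"
      using order_trans[OF Q_bound mult_left_mono[OF assms]] B_pos C by (intro mult_left_mono) auto
    finally show ?thesis by (simp add: mult_ac)
  qed
  then have "Q d = 0" using le_geometric_imp_le_0 N_eq_0_imp by metis
  with \<open>P d = 0\<close> show ?thesis using P_plus_Q[of d] by simp
qed

text \<open>For covectors the times are reversed: \<eta> is tested on \<open>P v\<close> at late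
  times and on \<open>Q v\<close> at early times, where these vectors are small in
  \<open>N n\<close>.\<close>

lemma bounded_constant_covec_eq_0:
  fixes \<eta> :: "'e \<Rightarrow>\<^sub>L real"
  assumes "b \<ge> 0" "\<And>n v. \<bar>\<eta> v\<bar> \<le> b * N n v"
  shows "\<eta> = 0"
proof (rule blinfun_eqI)
  fix v
  have "\<bar>\<eta> (P v)\<bar> \<le> (b * C * N 0 (P v)) * r ^ k" for k
    using order_trans[OF assms(2)[of "P v" "int k"] mult_left_mono[OF stable[of 0 k v, simplified] assms(1)]]
    by (simp add: mult_ac)
  then have P: "\<eta> (P v) = 0" using le_geometric_imp_le_0 by (metis abs_le_zero_iff)
  have "\<bar>\<eta> (Q v)\<bar> \<le> (b * C * N 0 (Q v)) * r ^ k" for k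
    using order_trans[OF assms(2)[of "Q v" "- int k"] mult_left_mono[OF unstable[of "- int k" v k, simplified] assms(1)]]
    by (simp add: mult_ac)
  then have "\<eta> (Q v) = 0" using le_geometric_imp_le_0 by (metis abs_le_zero_iff)
  with P show "\<eta> v = (0::'e \<Rightarrow>\<^sub>L real) v"
    using P_plus_Q[of v] by (metis add.right_neutral blinfun.add_right zero_blinfun.rep_eq)
qed

lemma shadow_unique:
  assumes "bdd_vecs v" "\<And>n. v (n + 1) = v n + X (n + 1)"
    and "bdd_vecs w" "\<And>n. w (n + 1) = w n + X (n + 1)"
  shows "v = w"
proof
  fix n
  define d where "d n = v n - w n" for n
  have c: "d n = d 0" for n
    by (rule int_constant) (simp add: d_def assms(2,4))
  obtain b where "\<And>n. N n (d n) \<le> b"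
    using bdd_vecs_diff[OF assms(1,3)] unfolding bdd_vecs_def d_def by blast
  then have "d 0 = 0" using bounded_constant_eq_0 c by metis
  then show "v n = w n" using c[of n] by (simp add: d_def)
qed

lemma adjoint_unique:
  assumes "bdd_covecs \<nu>" "\<And>n. \<nu> n = \<nu> (n + 1) + \<omega> n"
    and "bdd_covecs \<nu>'" "\<And>n. \<nu>' n = \<nu>' (n + 1) + \<omega> n"
  shows "\<nu> = \<nu>'"
proof
  fix n
  define d where "d n = \<nu> n - \<nu>' n" for n
  have "d (n + 1) = d n" for n
    using assms(2)[of n] assms(4)[of n] by (simp add: d_def)
  then have c: "d n = d 0" for n by (rule int_constant)
  obtain b where b: "b \<ge> 0" "\<And>n v. \<bar>d n v\<bar> \<le> b * N n v"
    using bdd_covecsE[OF bdd_covecs_diff[OF assms(1,3)]] unfolding d_def by metis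
  then have "\<bar>d 0 v\<bar> \<le> b * N n v" for n v using c by metis
  then have "d 0 = 0" using bounded_constant_covec_eq_0 b(1) by metis
  then show "\<nu> n = \<nu>' n" using c[of n] by (simp add: d_def)
qed

text \<open>The stable components of X are summed over the past up to and including n, the unstable
  ones over the strict future with a minus sign; each series is taken in the direction in which it
  decays.\<close>

lemma shadow_exists:
  assumes "bdd_vecs X"
  shows "\<exists>v. bdd_vecs v \<and> (\<forall>n. v (n + 1) = v n + X (n + 1))"
proof -
  obtain b where b: "b \<ge> 0" "\<And>n. N n (X n) \<le> b" using bdd_vecsE[OF assms] by blast
  have PX: "N n (P (X m)) \<le> (C * B * b) * r ^ k" if "n = m + int k" for n m k
  proof -
    have "N n (P (X m)) \<le> C * r ^ k * N m (P (X m))" using stable that by simp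
    also have "\<dots> \<le> C * r ^ k * (B * b)"
      using order_trans[OF P_bound mult_left_mono[OF b(2)]] B_pos C_pos r_pos
      by (intro mult_left_mono) auto
    finally show ?thesis by (simp add: mult_ac)
  qed
  have QX: "N n (Q (X m)) \<le> (C * B * b) * r ^ k" if "m = n + 1 + int k" for n m k
  proof -
    \<comment> \<open>The future series starts at n + 1, so the time difference is k + 1; the spare
      factor r is dropped afterwards to share one bound with the past series.\<close>
    have "N n (Q (X m)) \<le> C * r ^ Suc k * N m (Q (X m))"
      using unstable[of n "X m" "Suc k"] that by (simp add: algebra_simps)
    also have "\<dots> \<le> C * r ^ Suc k * (B * b)"
      using order_trans[OF Q_bound mult_left_mono[OF b(2)]] B_pos C_pos r_pos
      by (intro mult_left_mono) auto
    also have "\<dots> \<le> C * r ^ k * (B * b)"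
      using B_pos C_pos r_pos r_less_1 b(1) by (intro mult_right_mono mult_left_mono power_decreasing) auto
    finally show ?thesis by (simp add: mult_ac)
  qed
  define S where "S n = (\<Sum>k. P (X (n - int k)))" for n
  define U where "U n = (\<Sum>k. Q (X (n + 1 + int k)))" for n
  have sS: "summable (\<lambda>k. P (X (n - int k)))" "N n (S n) \<le> C * B * b / (1 - r)" for n
    unfolding S_def by (rule vec_series; rule PX; simp)+
  have sU: "summable (\<lambda>k. Q (X (n + 1 + int k)))" "N n (U n) \<le> C * B * b / (1 - r)" for n
    unfolding U_def by (rule vec_series; rule QX; simp)+
  have "bdd_vecs (\<lambda>n. S n - U n)"
    unfolding bdd_vecs_def using order_trans[OF N_diff add_mono[OF sS(2) sU(2)]] by blast
  moreover have "S (n + 1) - U (n + 1) = S n - U n + X (n + 1)" for n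
  proof -
    \<comment> \<open>Advancing n adds the newest term to the past series and removes the first term
      of the future series; the two projections of \<open>X (n + 1)\<close> recombine.\<close>
    have "S (n + 1) = S n + P (X (n + 1))"
      using suminf_split_head[OF sS(1)[of "n + 1"]] unfolding S_def by (simp add: algebra_simps)
    moreover have "U (n + 1) = U n - Q (X (n + 1))"
      using suminf_split_head[OF sU(1)[of n]] unfolding U_def by (simp add: algebra_simps)
    ultimately have "S (n + 1) - U (n + 1) = S n - U n + (P (X (n + 1)) + Q (X (n + 1)))"
      by simp
    then show ?thesis by (simp only: P_plus_Q)
  qed
  ultimately show ?thesis by (intro exI[of _ "\<lambda>n. S n - U n"]) simp
qed

section \<open>The series solution of the adjoint equation\<close>

context
  fixes \<omega> :: "int \<Rightarrow> 'e \<Rightarrow>\<^sub>L real"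
  assumes \<omega>: "bdd_covecs \<omega>"
begin

text \<open>\<open>P v\<close> shrinks at later times and \<open>Q v\<close> at earlier ones, so
  bounded covectors composed with these projections decay geometrically when evaluated at a fixed
  vector.\<close>

lemma adjoint_series_bounds:
  shows "\<exists>\<beta>. (\<forall>n k v. \<bar>(\<omega> (n + int k) o\<^sub>L P) v\<bar> \<le> \<beta> * r ^ k * N n v) \<and>
    (\<forall>n k v. \<bar>(\<omega> (n - 1 - int k) o\<^sub>L Q) v\<bar> \<le> \<beta> * r ^ k * N n v)"
proof -
  obtain b where b: "b \<ge> 0" "\<And>n v. \<bar>\<omega> n v\<bar> \<le> b * N n v" using bdd_covecsE[OF \<omega>] by blast
  have "\<bar>\<omega> (n + int k) (P v)\<bar> \<le> (b * C * B) * r ^ k * N n v" for n k v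
  proof -
    have "\<bar>\<omega> (n + int k) (P v)\<bar> \<le> b * N (n + int k) (P v)" by (rule b)
    also have "\<dots> \<le> b * (C * r ^ k * (B * N n v))"
      using order_trans[OF stable mult_left_mono[OF P_bound]] C_pos r_pos b(1)
      by (intro mult_left_mono) auto
    finally show ?thesis by (simp add: mult_ac)
  qed
  moreover have "\<bar>\<omega> (n - 1 - int k) (Q v)\<bar> \<le> (b * C * B) * r ^ k * N n v" for n k v
  proof -
    have "\<bar>\<omega> (n - 1 - int k) (Q v)\<bar> \<le> b * N (n - 1 - int k) (Q v)" by (rule b)
    also have "\<dots> \<le> b * (C * r ^ Suc k * N n (Q v))"
      using unstable[of "n - 1 - int k" v "Suc k"] b(1) by (intro mult_left_mono) auto
    also have "\<dots> \<le> b * (C * r ^ k * (B * N n v))"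
      using Q_bound C_pos r_pos r_less_1 b(1) N_nonneg
      by (intro mult_left_mono mult_mono power_decreasing) auto
    finally show ?thesis by (simp add: mult_ac)
  qed
  ultimately show ?thesis by (intro exI[of _ "b * C * B"]) simp
qed

text \<open>Absolute summability is recorded because the expansion formula is stated with unordered
  sums.\<close>

lemma adjoint_series_summable:
  shows "summable (\<lambda>k. norm (\<omega> (n + int k) o\<^sub>L P))" "summable (\<lambda>k. norm (\<omega> (n - 1 - int k) o\<^sub>L Q))"
proof -
  obtain \<beta> where \<beta>: "\<And>n k v. \<bar>(\<omega> (n + int k) o\<^sub>L P) v\<bar> \<le> \<beta> * r ^ k * N n v"
    "\<And>n k v. \<bar>(\<omega> (n - 1 - int k) o\<^sub>L Q) v\<bar> \<le> \<beta> * r ^ k * N n v"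
    using adjoint_series_bounds by blast
  show "summable (\<lambda>k. norm (\<omega> (n + int k) o\<^sub>L P))"
    by (rule covec_series(1), rule \<beta>(1))
  show "summable (\<lambda>k. norm (\<omega> (n - 1 - int k) o\<^sub>L Q))"
    by (rule covec_series(1), rule \<beta>(2))
qed

text \<open>The expansion formula in the common frame, where pullbacks are identities. The index
  \<open>n - 1 - int k\<close> enumerates the negative steps, starting with step -1.\<close>

definition adjoint_series :: "int \<Rightarrow> 'e \<Rightarrow>\<^sub>L real" where
  "adjoint_series n = (\<Sum>k. \<omega> (n + int k) o\<^sub>L P) - (\<Sum>k. \<omega> (n - 1 - int k) o\<^sub>L Q)"

lemma adjoint_series_bounded: "bdd_covecs adjoint_series"
proof -
  obtain \<beta> where \<beta>: "\<And>n k v. \<bar>(\<omega> (n + int k) o\<^sub>L P) v\<bar> \<le> \<beta> * r ^ k * N n v"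
    "\<And>n k v. \<bar>(\<omega> (n - 1 - int k) o\<^sub>L Q) v\<bar> \<le> \<beta> * r ^ k * N n v"
    using adjoint_series_bounds by blast
  have "\<bar>(\<Sum>k. \<omega> (n + int k) o\<^sub>L P) v\<bar> \<le> \<beta> / (1 - r) * N n v" for n v
    by (rule covec_series(2), rule \<beta>(1))
  moreover have "\<bar>(\<Sum>k. \<omega> (n - 1 - int k) o\<^sub>L Q) v\<bar> \<le> \<beta> / (1 - r) * N n v" for n v
    by (rule covec_series(2), rule \<beta>(2))
  ultimately have "bdd_covecs (\<lambda>n. \<Sum>k. \<omega> (n + int k) o\<^sub>L P)" "bdd_covecs (\<lambda>n. \<Sum>k. \<omega> (n - 1 - int k) o\<^sub>L Q)"
    unfolding bdd_covecs_def by blast+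
  then show ?thesis
    unfolding adjoint_series_def[abs_def] by (rule bdd_covecs_diff)
qed

text \<open>Going from n to n + 1, the first series loses its head
  \<open>\<omega> n o\<^sub>L P\<close> and the second gains the head
  \<open>\<omega> n o\<^sub>L Q\<close>; the two heads add up to \<omega> at n.\<close>

lemma adjoint_series_solution: "adjoint_series n = adjoint_series (n + 1) + \<omega> n"
proof -
  have "(\<Sum>k. \<omega> (n + int k) o\<^sub>L P) = (\<Sum>k. \<omega> (n + 1 + int k) o\<^sub>L P) + (\<omega> n o\<^sub>L P)"
    using suminf_split_head[OF summable_norm_cancel[OF adjoint_series_summable(1)[of n]]]
    by (simp add: algebra_simps)
  moreover have "(\<Sum>k. \<omega> (n + 1 - 1 - int k) o\<^sub>L Q) = (\<Sum>k. \<omega> (n - 1 - int k) o\<^sub>L Q) + (\<omega> n o\<^sub>L Q)"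
    using suminf_split_head[OF summable_norm_cancel[OF adjoint_series_summable(2)[of "n + 1"]]]
    by (simp add: algebra_simps)
  moreover have "\<omega> n = (\<omega> n o\<^sub>L P) + (\<omega> n o\<^sub>L Q)"
    by (rule blinfun_eqI) (simp add: plus_blinfun.rep_eq blinfun.add_right[symmetric] P_plus_Q)
  ultimately show ?thesis
    unfolding adjoint_series_def by (simp add: algebra_simps)
qed

lemma adjoint_solution_iff_series:
  assumes "bdd_covecs \<nu>"
  shows "(\<forall>n. \<nu> n = \<nu> (n + 1) + \<omega> n) \<longleftrightarrow> (\<forall>n. \<nu> n = adjoint_series n)"
proof
  assume \<nu>: "\<forall>n. \<nu> n = \<nu> (n + 1) + \<omega> n"
  have "\<nu> = adjoint_series"
  proof (rule adjoint_unique[where \<omega> = \<omega>])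
    show "\<nu> n = \<nu> (n + 1) + \<omega> n" for n using \<nu> by blast
    show "adjoint_series n = adjoint_series (n + 1) + \<omega> n" for n by (rule adjoint_series_solution)
  qed (rule assms adjoint_series_bounded)+
  then show "\<forall>n. \<nu> n = adjoint_series n" by simp
next
  assume \<nu>: "\<forall>n. \<nu> n = adjoint_series n"
  show "\<forall>n. \<nu> n = \<nu> (n + 1) + \<omega> n"
    unfolding \<nu>[rule_format] by (rule allI adjoint_series_solution)+
qed

end

section \<open>Telescoping of the averaged pairings\<close>

lemma telescoping_average:
  assumes \<nu>: "bdd_covecs \<nu>" and \<nu>_eq: "\<And>n. \<nu> n = \<nu> (n + 1) + \<omega> n"
    and X: "bdd_vecs X" and v: "bdd_vecs v" and v_eq: "\<And>n. v (n + 1) = v n + X (n + 1)"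
  shows "(\<lambda>T::nat. 1 / (2 * real T + 1) * (\<Sum>n = - int T..int T. \<omega> n (v n))
      - 1 / (2 * real T + 1) * (\<Sum>n = - int T..int T. \<nu> n (X n))) \<longlonglongrightarrow> 0"
proof -
  obtain b where b: "b \<ge> 0" "\<And>n v. \<bar>\<nu> n v\<bar> \<le> b * N n v" using bdd_covecsE[OF \<nu>] by blast
  obtain b1 where b1: "b1 \<ge> 0" "\<And>n. N n (X n) \<le> b1" using bdd_vecsE[OF X] by blast
  obtain b2 where b2: "b2 \<ge> 0" "\<And>n. N n (v n) \<le> b2" using bdd_vecsE[OF v] by blast
  \<comment> \<open>The boundary term of the telescoping sum. A bound for \<open>v (n - 1)\<close>
    is available in \<open>N (n - 1)\<close>, but one in \<open>N n\<close> is wanted; writing it as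
    \<open>v n - X n\<close> keeps everything at time n.\<close>
  define h where "h n = \<nu> n (v (n - 1))" for n
  have v': "v (n - 1) = v n - X n" for n using v_eq[of "n - 1"] by simp
  have h_bound: "\<bar>h n\<bar> \<le> b * (b1 + b2)" for n
  proof -
    have "N n (v (n - 1)) \<le> b1 + b2"
      unfolding v' using N_diff[of n "v n" "X n"] b1(2)[of n] b2(2)[of n] by linarith
    then show ?thesis
      unfolding h_def using order_trans[OF b(2)] mult_left_mono[OF _ b(1)] by blast
  qed
  have diff: "\<omega> n (v n) - \<nu> n (X n) = h n - h (n + 1)" for n
  proof -
    have "\<omega> n = \<nu> n - \<nu> (n + 1)" using \<nu>_eq[of n] by (simp add: algebra_simps)
    then show ?thesis unfolding h_def v'[of n]
      by (simp add: blinfun.diff_left blinfun.diff_right)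
  qed
  have tele: "(\<Sum>n = - int T..int T. h n - h (n + 1)) = h (- int T) - h (int T + 1)" for T :: nat
  proof (induction T)
    case (Suc T)
    \<comment> \<open>The window grows at both ends, so each induction step inserts two
      terms.\<close>
    have "{- int (Suc T)..int (Suc T)} = insert (- int (Suc T)) (insert (int (Suc T)) {- int T..int T})"
      by auto
    then show ?case using Suc by (simp add: algebra_simps)
  qed simp
  have "\<forall>T::nat. norm (1 / (2 * real T + 1) * (\<Sum>n = - int T..int T. \<omega> n (v n))
      - 1 / (2 * real T + 1) * (\<Sum>n = - int T..int T. \<nu> n (X n))) \<le> (2 * b * (b1 + b2)) / (2 * real T + 1)"
  proof
    fix T :: nat
    have "(\<Sum>n = - int T..int T. \<omega> n (v n)) - (\<Sum>n = - int T..int T. \<nu> n (X n)) = h (- int T) - h (int T + 1)"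
      unfolding sum_subtractf[symmetric] diff by (rule tele)
    then have "\<bar>(\<Sum>n = - int T..int T. \<omega> n (v n)) - (\<Sum>n = - int T..int T. \<nu> n (X n))\<bar> \<le> 2 * b * (b1 + b2)"
      using h_bound[of "- int T"] h_bound[of "int T + 1"] by linarith
    then show "norm (1 / (2 * real T + 1) * (\<Sum>n = - int T..int T. \<omega> n (v n))
      - 1 / (2 * real T + 1) * (\<Sum>n = - int T..int T. \<nu> n (X n))) \<le> (2 * b * (b1 + b2)) / (2 * real T + 1)"
      unfolding right_diff_distrib[symmetric] by (simp add: divide_right_mono)
  qed
  note always_eventually[OF this, of sequentially]
  moreover have "(\<lambda>T::nat. (2 * b * (b1 + b2)) / (2 * real T + 1)) \<longlonglongrightarrow> 0"
    by (rule tendsto_divide_0[OF tendsto_const])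
      (auto intro!: filterlim_at_top_imp_at_infinity filterlim_tendsto_add_at_top
        filterlim_tendsto_pos_mult_at_top[OF tendsto_const] filterlim_real_sequentially
        simp: add.commute[of _ 1])
  ultimately show ?thesis
    by (rule Lim_null_comparison)
qed

end

section \<open>Riemannian norms on fibres\<close>

lemma bilinear_Cauchy_Schwarz:
  fixes h :: "'e::euclidean_space \<Rightarrow> 'e \<Rightarrow> real"
  assumes bil: "bilinear h" and sym: "\<And>v w. h v w = h w v" and nonneg: "\<And>v. h v v \<ge> 0"
    and pos: "h w w > 0"
  shows "(h v w)\<^sup>2 \<le> h v v * h w w"
proof -
  \<comment> \<open>The value of t that minimises the form on v - t w.\<close>
  let ?t = "h v w / h w w"
  have "h (v - ?t *\<^sub>R w) (v - ?t *\<^sub>R w) = h v v - 2 * ?t * h v w + ?t * ?t * h w w"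
    by (simp add: bilinear_lsub[OF bil] bilinear_rsub[OF bil] bilinear_lmul[OF bil]
        bilinear_rmul[OF bil] sym[of w v] algebra_simps)
  also have "\<dots> = h v v - (h v w)\<^sup>2 / h w w"
    using pos by (simp add: field_simps power2_eq_square)
  finally have "(h v w)\<^sup>2 / h w w \<le> h v v"
    using nonneg[of "v - ?t *\<^sub>R w"] by simp
  then show ?thesis using pos by (simp add: field_simps)
qed

context
  fixes A :: "('m, 'e::euclidean_space) chart set" and g :: "'m \<Rightarrow> 'e \<Rightarrow> 'e \<Rightarrow> real"
  assumes met: "riemannian_metric A g"
begin

lemma metric_bilinear: "bilinear (g p)"
  and metric_sym: "g p v w = g p w v"
  and metric_pos: "v \<noteq> 0 \<Longrightarrow> g p v v > 0"
  using met unfolding riemannian_metric_def by blast+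

lemma metric_nonneg: "g p v v \<ge> 0"
  by (cases "v = 0") (auto simp: metric_pos less_imp_le bilinear_lzero[OF metric_bilinear])

lemma vec_norm_nonneg: "vec_norm g (p, v) \<ge> 0"
  by (simp add: vec_norm_def metric_nonneg)

lemma vec_norm_scaleR: "vec_norm g (p, c *\<^sub>R v) = \<bar>c\<bar> * vec_norm g (p, v)"
  by (simp add: vec_norm_def bilinear_lmul[OF metric_bilinear] bilinear_rmul[OF metric_bilinear]
      real_sqrt_mult mult.assoc[symmetric])

lemma vec_norm_triangle: "vec_norm g (p, v + w) \<le> vec_norm g (p, v) + vec_norm g (p, w)"
proof (cases "w = 0")
  case False
  have "(g p v w)\<^sup>2 \<le> g p v v * g p w w"
    by (rule bilinear_Cauchy_Schwarz[OF metric_bilinear metric_sym metric_nonneg metric_pos[OF False]])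
  then have "\<bar>g p v w\<bar> \<le> sqrt (g p v v * g p w w)"
    using real_le_rsqrt by fastforce
  then have "g p v w \<le> sqrt (g p v v) * sqrt (g p w w)"
    by (simp add: real_sqrt_mult)
  moreover have "g p (v + w) (v + w) = g p v v + 2 * g p v w + g p w w"
    by (simp add: bilinear_ladd[OF metric_bilinear] bilinear_radd[OF metric_bilinear] metric_sym[of p w v])
  ultimately have "g p (v + w) (v + w) \<le> (sqrt (g p v v) + sqrt (g p w w))\<^sup>2"
    by (simp add: power2_sum metric_nonneg)
  then show ?thesis
    unfolding vec_norm_def by (auto intro!: real_le_lsqrt simp: metric_nonneg)
qed (simp add: vec_norm_nonneg)

lemma vec_norm_equiv: "\<exists>\<kappa>>0. \<forall>v. norm v \<le> \<kappa> * vec_norm g (p, v) \<and> vec_norm g (p, v) \<le> \<kappa> * norm v"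
proof -
  obtain m where m: "m > 0" "\<And>v. m * (norm v)\<^sup>2 \<le> g p v v"
    using posdef_lower_bound[OF metric_bilinear metric_pos, of p] by blast
  obtain M where M: "M > 0" "\<And>v. g p v v \<le> M * (norm v)\<^sup>2"
    using bilinear_upper_bound[OF metric_bilinear, of p] by blast
  have a: "sqrt m * norm v \<le> vec_norm g (p, v)" for v
    using real_sqrt_le_mono[OF m(2)[of v]] by (simp add: vec_norm_def real_sqrt_mult)
  have b: "vec_norm g (p, v) \<le> sqrt M * norm v" for v
    using real_sqrt_le_mono[OF M(2)[of v]] by (simp add: vec_norm_def real_sqrt_mult)
  \<comment> \<open>The sum of the two constants serves in both directions.\<close>
  let ?k = "1 / sqrt m + sqrt M"
  have "norm v \<le> ?k * vec_norm g (p, v)" for v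
  proof -
    have "norm v \<le> 1 / sqrt m * vec_norm g (p, v)" using a[of v] m(1) by (simp add: field_simps)
    also have "\<dots> \<le> ?k * vec_norm g (p, v)" using M(1) vec_norm_nonneg by (intro mult_right_mono) auto
    finally show ?thesis .
  qed
  moreover have "vec_norm g (p, v) \<le> ?k * norm v" for v
  proof -
    have "sqrt M * norm v \<le> ?k * norm v" using m(1) by (intro mult_right_mono) auto
    then show ?thesis using b[of v] by linarith
  qed
  moreover have "?k > 0" using m(1) M(1) by (simp add: add_pos_pos)
  ultimately show ?thesis by blast
qed

lemma covec_norm_upper: "\<bar>blinfun_apply \<eta> v\<bar> \<le> covec_norm g (p, \<eta>) * vec_norm g (p, v)"
proof -
  obtain \<kappa> where \<kappa>: "\<kappa> > 0" "\<And>v. norm v \<le> \<kappa> * vec_norm g (p, v)"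
    using vec_norm_equiv by blast
  have "\<bar>blinfun_apply \<eta> v\<bar> \<le> norm \<eta> * \<kappa>" if "vec_norm g (p, v) \<le> 1" for v
  proof -
    have "norm v \<le> \<kappa> * 1" using \<kappa>(2)[of v] mult_left_mono[OF that, of \<kappa>] \<kappa>(1) by linarith
    then have "norm \<eta> * norm v \<le> norm \<eta> * \<kappa>" by (simp add: mult_left_mono)
    then show ?thesis using norm_blinfun[of \<eta> v] by simp
  qed
  \<comment> \<open>Boundedness on the unit ball of g makes the supremum in
    \<open>covec_norm\<close> a genuine upper bound.\<close>
  then have bdd: "bdd_above ((\<lambda>v. \<bar>blinfun_apply \<eta> v\<bar>) ` {v. vec_norm g (p, v) \<le> 1})"
    by (intro bdd_aboveI2[of _ _ "norm \<eta> * \<kappa>"]) simp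
  show ?thesis
  proof (cases "v = 0")
    case False
    let ?n = "vec_norm g (p, v)"
    have n: "?n > 0" using metric_pos[OF False] by (simp add: vec_norm_def)
    have "vec_norm g (p, v /\<^sub>R ?n) \<le> 1" using n by (simp add: vec_norm_scaleR)
    then have "\<bar>blinfun_apply \<eta> (v /\<^sub>R ?n)\<bar> \<le> covec_norm g (p, \<eta>)"
      unfolding covec_norm_def prod.case by (intro cSUP_upper[OF _ bdd]) simp
    then show ?thesis using n by (simp add: blinfun.scaleR_right abs_mult field_simps)
  qed (simp add: vec_norm_def bilinear_lzero[OF metric_bilinear])
qed

lemma covec_norm_least:
  assumes "b \<ge> 0" "\<And>v. \<bar>blinfun_apply \<eta> v\<bar> \<le> b * vec_norm g (p, v)"
  shows "covec_norm g (p, \<eta>) \<le> b"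
  unfolding covec_norm_def prod.case
proof (rule cSUP_least)
  show "{v. vec_norm g (p, v) \<le> 1} \<noteq> {}"
    using vec_norm_scaleR[of p 0 0] by (auto intro!: exI[of _ 0])
  fix v assume "v \<in> {v. vec_norm g (p, v) \<le> 1}"
  then show "\<bar>blinfun_apply \<eta> v\<bar> \<le> b"
    using assms(2)[of v] mult_left_mono[of "vec_norm g (p, v)" 1 b] assms(1) by simp
qed

text \<open>Replaces the supremum by pointwise inequalities, the form used in
  \<open>bdd_covecs\<close>. In the converse direction b is replaced by its absolute value, since
  \<open>covec_norm_least\<close> asks for a nonnegative bound.\<close>

lemma bounded_covecs_iff:
  "\<eta> \<in> bounded_covecs g x \<longleftrightarrow> (\<exists>b. \<forall>n v. \<bar>blinfun_apply (\<eta> n) v\<bar> \<le> b * vec_norm g (x n, v))"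
proof
  assume "\<eta> \<in> bounded_covecs g x"
  then obtain b where b: "\<And>n. covec_norm g (x n, \<eta> n) \<le> b" unfolding bounded_covecs_def by blast
  have "\<bar>blinfun_apply (\<eta> n) v\<bar> \<le> b * vec_norm g (x n, v)" for n v
    using covec_norm_upper[of "\<eta> n" v "x n"] mult_right_mono[OF b vec_norm_nonneg, of n "x n" v] by linarith
  then show "\<exists>b. \<forall>n v. \<bar>blinfun_apply (\<eta> n) v\<bar> \<le> b * vec_norm g (x n, v)" by blast
next
  assume "\<exists>b. \<forall>n v. \<bar>blinfun_apply (\<eta> n) v\<bar> \<le> b * vec_norm g (x n, v)"
  then obtain b where b: "\<And>n v. \<bar>blinfun_apply (\<eta> n) v\<bar> \<le> b * vec_norm g (x n, v)" by blast
  have "\<bar>blinfun_apply (\<eta> n) v\<bar> \<le> \<bar>b\<bar> * vec_norm g (x n, v)" for n v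
    using b[of n v] mult_right_mono[OF abs_ge_self[of b] vec_norm_nonneg[of "x n" v]] by linarith
  then have "covec_norm g (x n, \<eta> n) \<le> \<bar>b\<bar>" for n
    by (intro covec_norm_least) auto
  then show "\<eta> \<in> bounded_covecs g x" unfolding bounded_covecs_def by blast
qed

end

section \<open>A common frame for the fibres along an orbit\<close>

lemma blinfun_compose_assoc: "(F o\<^sub>L G) o\<^sub>L H = F o\<^sub>L (G o\<^sub>L H)"
  by (rule blinfun_eqI) simp

lemma blinfun_compose_id [simp]: "F o\<^sub>L id_blinfun = F" "id_blinfun o\<^sub>L F = F"
  by (rule blinfun_eqI, simp)+

text \<open>In finite dimension a linear right inverse is two-sided, and it is bounded.\<close>

lemma surj_blinfun_inverse:
  fixes D :: "'e::euclidean_space \<Rightarrow>\<^sub>L 'e"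
  assumes "surj (blinfun_apply D)"
  shows "\<exists>E. E o\<^sub>L D = id_blinfun \<and> D o\<^sub>L E = id_blinfun"
proof -
  have D: "linear (blinfun_apply D)" by (rule bounded_linear.linear[OF blinfun.bounded_linear_right])
  obtain h where h: "linear h" "blinfun_apply D \<circ> h = id"
    using linear_surjective_right_inverse[OF D assms] by blast
  moreover have "h \<circ> blinfun_apply D = id" using linear_inverse_left[OF D h(1)] h(2) by simp
  moreover have "blinfun_apply (Blinfun h) = h"
    using h(1) by (simp add: bounded_linear_Blinfun_apply linear_conv_bounded_linear)
  ultimately show ?thesis
    by (intro exI[of _ "Blinfun h"]) (auto intro!: blinfun_eqI simp: fun_eq_iff)
qed

text \<open>In the common frame \<open>M\<close> of all fibres along an orbit the cocycle \<open>D\<close> becomes the identity.\<close>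

lemma orbit_frame_exists:
  fixes D :: "int \<Rightarrow> 'e::euclidean_space \<Rightarrow>\<^sub>L 'e"
  assumes "\<And>n. surj (blinfun_apply (D n))"
  shows "\<exists>M Mi :: int \<Rightarrow> 'e \<Rightarrow>\<^sub>L 'e. \<forall>n. M (n + 1) = D n o\<^sub>L M n \<and> Mi n o\<^sub>L M n = id_blinfun \<and> M n o\<^sub>L Mi n = id_blinfun"
proof -
  obtain E where E: "\<And>n. E n o\<^sub>L D n = id_blinfun" "\<And>n. D n o\<^sub>L E n = id_blinfun"
    using surj_blinfun_inverse[OF assms] by metis
  have DE: "D n o\<^sub>L (E n o\<^sub>L G) = G" "E n o\<^sub>L (D n o\<^sub>L G) = G" "(G o\<^sub>L D n) o\<^sub>L E n = G" "(G o\<^sub>L E n) o\<^sub>L D n = G"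
    for n and G :: "'e \<Rightarrow>\<^sub>L 'e"
    by (simp_all add: blinfun_compose_assoc[symmetric] E) (simp_all add: blinfun_compose_assoc E)
  \<comment> \<open>Starting from the identity at time 0, the cocycle is multiplied on forwards and
    its inverse backwards; the step from -k to -k-1 uses the inverse of D at -k-1.\<close>
  define M where "M n = (if n \<ge> 0 then rec_nat id_blinfun (\<lambda>k m. D (int k) o\<^sub>L m) (nat n)
      else rec_nat id_blinfun (\<lambda>k m. E (- int k - 1) o\<^sub>L m) (nat (- n)))" for n
  have step: "M (n + 1) = D n o\<^sub>L M n" for n
  proof (cases "n \<ge> 0")
    case True
    then have "nat (n + 1) = Suc (nat n)" by simp
    then show ?thesis using True by (simp add: M_def)
  next
    case False
    then have "nat (- n) = Suc (nat (- (n + 1)))" by simp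
    then have "M n = E n o\<^sub>L M (n + 1)" using False by (simp add: M_def)
    then show ?thesis by (simp add: DE)
  qed
  \<comment> \<open>Invertibility spreads from time 0 both ways: an inverse G of \<open>M i\<close>
    gives \<open>G o\<^sub>L E i\<close> at i + 1 and \<open>G o\<^sub>L D (i - 1)\<close> at i -
    1.\<close>
  have "\<exists>G. G o\<^sub>L M n = id_blinfun \<and> M n o\<^sub>L G = id_blinfun" for n
  proof (induction n rule: int_induct[where k = 0])
    case base
    show ?case by (auto simp: M_def)
  next
    case (step1 i)
    then obtain G where G: "G o\<^sub>L M i = id_blinfun" "M i o\<^sub>L G = id_blinfun" by blast
    have "(G o\<^sub>L E i) o\<^sub>L M (i + 1) = id_blinfun"
      by (simp add: step blinfun_compose_assoc DE G)
    moreover have "M (i + 1) o\<^sub>L (G o\<^sub>L E i) = D i o\<^sub>L (M i o\<^sub>L G) o\<^sub>L E i"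
      by (simp add: step blinfun_compose_assoc)
    then have "M (i + 1) o\<^sub>L (G o\<^sub>L E i) = id_blinfun" by (simp add: G E)
    ultimately show ?case by blast
  next
    case (step2 i)
    then obtain G where G: "G o\<^sub>L M i = id_blinfun" "M i o\<^sub>L G = id_blinfun" by blast
    have Mi: "M i = D (i - 1) o\<^sub>L M (i - 1)" using step[of "i - 1"] by simp
    then have Mi': "M (i - 1) = E (i - 1) o\<^sub>L M i" by (simp add: DE)
    have "(G o\<^sub>L D (i - 1)) o\<^sub>L M (i - 1) = id_blinfun"
      using G Mi by (simp add: blinfun_compose_assoc)
    moreover have "M (i - 1) o\<^sub>L (G o\<^sub>L D (i - 1)) = E (i - 1) o\<^sub>L (M i o\<^sub>L G) o\<^sub>L D (i - 1)"
      by (simp add: Mi' blinfun_compose_assoc)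
    then have "M (i - 1) o\<^sub>L (G o\<^sub>L D (i - 1)) = id_blinfun" by (simp add: G E)
    ultimately show ?case by blast
  qed
  then obtain Mi where "\<And>n. Mi n o\<^sub>L M n = id_blinfun \<and> M n o\<^sub>L Mi n = id_blinfun" by metis
  then show ?thesis using step by (intro exI[of _ M] exI[of _ Mi]) simp
qed

section \<open>Hyperbolic orbits\<close>

text \<open>Evaluates \<open>inv\<close> at one point with a unique preimage. This suits the bundle
  maps, whose preimages are determined here only over the orbit.\<close>

lemma inv_apply_eqI:
  assumes "F z = y" "\<And>z'. F z' = y \<Longrightarrow> z' = z"
  shows "inv F y = z"
  using assms by (metis f_inv_into_f rangeI)

text \<open>Passes from ordinary series over the naturals to the unordered sums over half-lines of
  integers in the expansion formula.\<close>

lemma has_sum_nat_reindex: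
  fixes a :: "nat \<Rightarrow> 'a::banach"
  assumes "summable (\<lambda>k. norm (a k))" "bij_betw h UNIV S" "\<And>k. F (h k) = a k"
  shows "(F has_sum suminf a) S"
proof -
  have "(a has_sum suminf a) UNIV"
    by (rule norm_summable_imp_has_sum[OF assms(1) summable_sums[OF summable_norm_cancel[OF assms(1)]]])
  then show ?thesis
    using has_sum_reindex_bij_betw[OF assms(2), of F] by (simp add: assms(3))
qed

text \<open>Collects the hyperbolic data along a single orbit together with a frame:
  \<open>M n\<close> maps the fixed space onto the fibre at \<open>x n\<close>, with inverse
  \<open>Mi n\<close>, and B is the uniform angle bound.\<close>

locale framed_orbit =
  fixes A :: "('m::topological_space, 'e::euclidean_space) chart set"
    and g :: "'m \<Rightarrow> 'e \<Rightarrow> 'e \<Rightarrow> real" and f :: "'m \<Rightarrow> 'm"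
    and Vs Vu :: "'m \<Rightarrow> 'e set" and x :: "int \<Rightarrow> 'm"
    and M Mi :: "int \<Rightarrow> 'e \<Rightarrow>\<^sub>L 'e" and C r B :: real
  assumes metric: "riemannian_metric A g" and bij: "bij f" and x_step: "x (n + 1) = f (x n)"
    and complementary: "complementary (Vs (x n)) (Vu (x n))"
    and Vs_step: "blinfun_apply (differential A f (x n)) ` Vs (x n) = Vs (x (n + 1))"
    and Vu_step: "blinfun_apply (differential A f (x n)) ` Vu (x n) = Vu (x (n + 1))"
    and M_step: "M (n + 1) = differential A f (x n) o\<^sub>L M n"
    and Mi_M: "Mi n o\<^sub>L M n = id_blinfun" and M_Mi: "M n o\<^sub>L Mi n = id_blinfun"
    and C_pos: "C > 0" and r_pos: "r > 0" and r_less_1: "r < 1" and B_pos: "B > 0"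
    and contraction: "v \<in> Vs (x n) \<Longrightarrow>
      vec_norm g (int_iterate (pushforward A f) (int k) (x n, v)) \<le> C * r ^ k * vec_norm g (x n, v)"
    and expansion: "v \<in> Vu (x n) \<Longrightarrow>
      vec_norm g (int_iterate (pushforward A f) (- int k) (x n, v)) \<le> C * r ^ k * vec_norm g (x n, v)"
    and angle_s: "a \<in> Vs (x n) \<Longrightarrow> b \<in> Vu (x n) \<Longrightarrow> vec_norm g (x n, a) \<le> B * vec_norm g (x n, a + b)"
    and angle_u: "a \<in> Vs (x n) \<Longrightarrow> b \<in> Vu (x n) \<Longrightarrow> vec_norm g (x n, b) \<le> B * vec_norm g (x n, a + b)"
begin

lemma Mi_M_apply [simp]: "Mi n (M n v) = v"
  using arg_cong[OF Mi_M, of "\<lambda>F. blinfun_apply F v"] by simp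

lemma M_Mi_apply [simp]: "M n (Mi n v) = v"
  using arg_cong[OF M_Mi, of "\<lambda>F. blinfun_apply F v"] by simp

lemma M_step_apply: "M (n + 1) v = differential A f (x n) (M n v)"
  by (simp add: M_step)

lemma differential_eq: "differential A f (x n) w = M (n + 1) (Mi n w)"
  by (simp add: M_step_apply)

lemma differential_inj: "differential A f (x n) v = differential A f (x n) w \<Longrightarrow> v = w"
  unfolding differential_eq by (metis Mi_M_apply M_Mi_apply)

text \<open>Invariance of the stable subbundle and injectivity of the differential: seen through the
  frame, membership is a truth value that does not change with time.\<close>

lemma M_Vs: "M n v \<in> Vs (x n) \<longleftrightarrow> M 0 v \<in> Vs (x 0)"
proof (rule int_constant)
  show "(M (n + 1) v \<in> Vs (x (n + 1))) = (M n v \<in> Vs (x n))" for n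
    unfolding M_step_apply Vs_step[symmetric] using differential_inj by blast
qed

lemma M_Vu: "M n v \<in> Vu (x n) \<longleftrightarrow> M 0 v \<in> Vu (x 0)"
proof (rule int_constant)
  show "(M (n + 1) v \<in> Vu (x (n + 1))) = (M n v \<in> Vu (x n))" for n
    unfolding M_step_apply Vu_step[symmetric] using differential_inj by blast
qed

definition N :: "int \<Rightarrow> 'e \<Rightarrow> real" where "N n v = vec_norm g (x n, M n v)"
text \<open>Built from the splitting at time 0; by invariance the same operator represents the
  stable projection at every time, as \<open>proj_s\<close> shows.\<close>

definition P :: "'e \<Rightarrow>\<^sub>L 'e" where "P = Mi 0 o\<^sub>L (proj_along Vs Vu (x 0) o\<^sub>L M 0)"
definition Q :: "'e \<Rightarrow>\<^sub>L 'e" where "Q = Mi 0 o\<^sub>L (proj_along Vu Vs (x 0) o\<^sub>L M 0)"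

lemma proj_add:
  assumes "a \<in> Vs (x n)" "b \<in> Vu (x n)"
  shows proj_s_add: "proj_along Vs Vu (x n) (a + b) = a"
    and proj_u_add: "proj_along Vu Vs (x n) (a + b) = b"
proof -
  show "proj_along Vs Vu (x n) (a + b) = a"
    by (rule proj_along_apply) (rule complementary assms)+
  show "proj_along Vu Vs (x n) (a + b) = b"
    unfolding add.commute[of a b]
    by (rule proj_along_apply) (rule complementary_sym[OF complementary] assms)+
qed

lemma P_Q:
  shows P_mem: "M n (P v) \<in> Vs (x n)" and Q_mem: "M n (Q v) \<in> Vu (x n)" and P_plus_Q': "P v + Q v = v"
proof -
  obtain a b where ab: "a \<in> Vs (x 0)" "b \<in> Vu (x 0)" "M 0 v = a + b"
    using complementary[of 0] unfolding complementary_def by metis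
  have PQ: "P v = Mi 0 a" "Q v = Mi 0 b"
    by (simp_all add: P_def Q_def ab(3) proj_add[OF ab(1,2)])
  show "M n (P v) \<in> Vs (x n)" "M n (Q v) \<in> Vu (x n)"
    unfolding M_Vs[of n] M_Vu[of n] PQ using ab by simp_all
  have "P v + Q v = Mi 0 (M 0 v)" by (simp only: PQ ab(3) blinfun.add_right)
  then show "P v + Q v = v" by simp
qed

lemma M_P_plus_M_Q: "M n (P v) + M n (Q v) = M n v"
  by (simp add: P_plus_Q' blinfun.add_right[symmetric])

lemma proj_s: "proj_along Vs Vu (x n) (M n v) = M n (P v)"
  using proj_s_add[OF P_mem Q_mem, of n v v] by (simp add: M_P_plus_M_Q)

lemma proj_u: "proj_along Vu Vs (x n) (M n v) = M n (Q v)"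
  using proj_u_add[OF P_mem Q_mem, of n v v] by (simp add: M_P_plus_M_Q)

lemma P_P': "P (P v) = P v"
proof -
  have "proj_along Vs Vu (x 0) (M 0 (P v) + 0) = M 0 (P v)"
    using complementary[of 0] by (intro proj_s_add P_mem) (simp add: complementary_def subspace_0)
  then have "M 0 (P (P v)) = M 0 (P v)" by (simp add: proj_s)
  then show ?thesis by (metis Mi_M_apply)
qed

lemma Q_Q': "Q (Q v) = Q v"
proof -
  have "proj_along Vu Vs (x 0) (0 + M 0 (Q v)) = M 0 (Q v)"
    using complementary[of 0] by (intro proj_u_add Q_mem) (simp add: complementary_def subspace_0)
  then have "M 0 (Q (Q v)) = M 0 (Q v)" by (simp add: proj_u)
  then show ?thesis by (metis Mi_M_apply)
qed

section \<open>The pushforward and the dichotomy in the frame\<close>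

lemma pushforward_orbit: "pushforward A f (x n, M n v) = (x (n + 1), M (n + 1) v)"
  by (simp add: pushforward_def x_step M_step_apply)

text \<open>Injectivity of f fixes the base point of a preimage, and injectivity of the differential
  over the orbit fixes its vector.\<close>

lemma inv_pushforward_orbit: "inv (pushforward A f) (x (n + 1), M (n + 1) v) = (x n, M n v)"
proof (rule inv_apply_eqI)
  show "pushforward A f (x n, M n v) = (x (n + 1), M (n + 1) v)" by (rule pushforward_orbit)
  fix z' assume z: "pushforward A f z' = (x (n + 1), M (n + 1) v)"
  obtain p w where z': "z' = (p, w)" by fastforce
  have "f p = f (x n)" using z by (simp add: z' pushforward_def x_step)
  then have "p = x n" using bij by (meson bij_def injD)
  moreover from this have "differential A f (x n) w = differential A f (x n) (M n v)"
    using z by (simp add: z' pushforward_def M_step_apply)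
  then have "w = M n v" by (rule differential_inj)
  ultimately show "z' = (x n, M n v)" by (simp add: z')
qed

lemma iterate_pushforward: "int_iterate (pushforward A f) (int k) (x n, M n v) = (x (n + int k), M (n + int k) v)"
proof -
  have "(pushforward A f ^^ k) (x n, M n v) = (x (n + int k), M (n + int k) v)"
  proof (induction k)
    case (Suc k)
    then show ?case using pushforward_orbit[of "n + int k" v] by (simp add: ac_simps)
  qed simp
  then show ?thesis by (simp add: int_iterate_def)
qed

lemma iterate_inv_pushforward:
  "int_iterate (pushforward A f) (- int k) (x (n + int k), M (n + int k) v) = (x n, M n v)"
proof -
  have "(inv (pushforward A f) ^^ k) (x (n + int k), M (n + int k) v) = (x n, M n v)"
  proof (induction k)
    case (Suc k)
    then show ?case using inv_pushforward_orbit[of "n + int k" v]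
      by (simp add: funpow_Suc_right ac_simps del: funpow.simps)
  qed simp
  then show ?thesis by (simp add: int_iterate_def)
qed

sublocale dichotomy N P Q C r B
proof
  fix n :: int and k :: nat and v w :: 'e
  show "N n (v + w) \<le> N n v + N n w"
    by (simp add: N_def blinfun.add_right vec_norm_triangle[OF metric])
  show "N n (- v) = N n v"
    using vec_norm_scaleR[OF metric, of "x n" "- 1" "M n v"] by (simp add: N_def blinfun.minus_right)
  show "N (n + int k) (P v) \<le> C * r ^ k * N n (P v)"
    using contraction[OF P_mem[of n v], of k] unfolding iterate_pushforward N_def .
  \<comment> \<open>The backward estimate is applied at time n + k and leads back to time n.\<close>
  show "N n (Q v) \<le> C * r ^ k * N (n + int k) (Q v)"
    using expansion[OF Q_mem[of "n + int k" v], of k] unfolding iterate_inv_pushforward N_def .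
  show "N n (P v) \<le> B * N n v" "N n (Q v) \<le> B * N n v"
    using angle_s[OF P_mem[of n v] Q_mem[of n v]] angle_u[OF P_mem[of n v] Q_mem[of n v]]
    by (simp_all add: N_def M_P_plus_M_Q)
  show "\<exists>\<kappa>>0. \<forall>v. norm v \<le> \<kappa> * N n v \<and> N n v \<le> \<kappa> * norm v"
  proof -
    obtain \<kappa> where \<kappa>: "\<kappa> > 0" "\<And>v. norm v \<le> \<kappa> * vec_norm g (x n, v)" "\<And>v. vec_norm g (x n, v) \<le> \<kappa> * norm v"
      using vec_norm_equiv[OF metric] by blast
    \<comment> \<open>These constants depend on n, as \<open>N_equiv\<close> permits.\<close>
    let ?a = "norm (M n) + 1" and ?b = "norm (Mi n) + 1"
    have ab: "?a > 0" "?b > 0" by (auto intro: add_nonneg_pos)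
    have nonneg: "N n v \<ge> 0" for v by (simp add: N_def vec_norm_nonneg[OF metric])
    have 1: "norm v \<le> (?b * \<kappa>) * N n v" for v
    proof -
      have "norm v \<le> norm (Mi n) * norm (M n v)" using norm_blinfun[of "Mi n" "M n v"] by simp
      also have "\<dots> \<le> ?b * (\<kappa> * N n v)" using \<kappa>(2) by (intro mult_mono) (auto simp: N_def)
      finally show ?thesis by simp
    qed
    have 2: "N n v \<le> (?a * \<kappa>) * norm v" for v
    proof -
      have "N n v \<le> \<kappa> * norm (M n v)" using \<kappa>(3) by (simp add: N_def)
      also have "\<dots> \<le> \<kappa> * (?a * norm v)"
        using norm_blinfun[of "M n" v] \<kappa>(1) by (intro mult_left_mono) (auto simp: distrib_right add_increasing2)
      finally show ?thesis by (simp only: mult_ac)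
    qed
    have "norm v \<le> (?a * \<kappa> + ?b * \<kappa>) * N n v \<and> N n v \<le> (?a * \<kappa> + ?b * \<kappa>) * norm v" for v
    proof
      have "(?b * \<kappa>) * N n v \<le> (?a * \<kappa> + ?b * \<kappa>) * N n v" "(?a * \<kappa>) * norm v \<le> (?a * \<kappa> + ?b * \<kappa>) * norm v"
        using ab \<kappa>(1) nonneg by (auto intro!: mult_right_mono)
      then show "norm v \<le> (?a * \<kappa> + ?b * \<kappa>) * N n v" "N n v \<le> (?a * \<kappa> + ?b * \<kappa>) * norm v"
        using 1[of v] 2[of v] by linarith+
    qed
    moreover have "?a * \<kappa> + ?b * \<kappa> > 0" by (rule add_pos_pos[OF mult_pos_pos[OF ab(1) \<kappa>(1)] mult_pos_pos[OF ab(2) \<kappa>(1)]])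
    ultimately show ?thesis by blast
  qed
qed (rule P_plus_Q' P_P' Q_Q' C_pos r_pos r_less_1 B_pos)+

section \<open>Sequences, the adjoint equation and the expansion formula in the frame\<close>

lemma bdd_vecs_iff: "bdd_vecs (\<lambda>n. Mi n (X n)) \<longleftrightarrow> X \<in> bounded_vecs g x"
  by (simp add: bdd_vecs_def bounded_vecs_def N_def)

lemma bdd_covecs_iff: "bdd_covecs (\<lambda>n. \<eta> n o\<^sub>L M n) \<longleftrightarrow> \<eta> \<in> bounded_covecs g x"
  unfolding bdd_covecs_def bounded_covecs_iff[OF metric] N_def by simp (metis M_Mi_apply)

lemma compose_M_cancel: "\<eta> o\<^sub>L M n = \<zeta> o\<^sub>L M n \<longleftrightarrow> \<eta> = \<zeta>"
  by (metis M_Mi blinfun_compose_assoc blinfun_compose_id(1))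

lemma eq_compose_Mi_iff: "\<eta> = \<zeta> o\<^sub>L Mi n \<longleftrightarrow> \<eta> o\<^sub>L M n = \<zeta>"
  by (auto simp: blinfun_compose_assoc M_Mi Mi_M)

text \<open>Composition with \<open>M n\<close> absorbs the pullback, because the differential at
  \<open>x n\<close> followed after \<open>M n\<close> is \<open>M (n + 1)\<close>; composition with
  \<open>M n\<close> can be cancelled.\<close>

lemma adjoint_equation_iff:
  "\<nu> n = codifferential A f (x n) (\<nu> (n + 1)) + \<omega> n \<longleftrightarrow>
    \<nu> n o\<^sub>L M n = (\<nu> (n + 1) o\<^sub>L M (n + 1)) + (\<omega> n o\<^sub>L M n)"
proof -
  have "(codifferential A f (x n) (\<nu> (n + 1)) + \<omega> n) o\<^sub>L M n = (\<nu> (n + 1) o\<^sub>L M (n + 1)) + (\<omega> n o\<^sub>L M n)"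
    by (rule blinfun_eqI) (simp add: codifferential_def M_step plus_blinfun.rep_eq)
  then show ?thesis using compose_M_cancel by metis
qed

lemma pullback_orbit: "pullback A f (x (n + 1), \<eta>) = (x n, \<eta> o\<^sub>L (M (n + 1) o\<^sub>L Mi n))"
proof -
  have "inv f (x (n + 1)) = x n" using bij by (simp add: x_step bij_is_inj)
  moreover have "differential A f (x n) = M (n + 1) o\<^sub>L Mi n"
    by (rule blinfun_eqI) (simp add: differential_eq)
  ultimately show ?thesis by (simp add: pullback_def codifferential_def)
qed

lemma inv_pullback_orbit: "inv (pullback A f) (x n, \<eta>) = (x (n + 1), \<eta> o\<^sub>L (M n o\<^sub>L Mi (n + 1)))"
proof (rule inv_apply_eqI)
  show "pullback A f (x (n + 1), \<eta> o\<^sub>L (M n o\<^sub>L Mi (n + 1))) = (x n, \<eta>)"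
    unfolding pullback_orbit by (auto intro!: blinfun_eqI)
  fix z' assume z: "pullback A f z' = (x n, \<eta>)"
  obtain q \<zeta> where z': "z' = (q, \<zeta>)" by fastforce
  have "inv f q = x n" using z by (simp add: z' pullback_def)
  then have q: "q = x (n + 1)" using bij by (metis x_step bij_inv_eq_iff)
  then have "\<eta> = \<zeta> o\<^sub>L (M (n + 1) o\<^sub>L Mi n)" using z by (simp add: z' pullback_orbit)
  then show "z' = (x (n + 1), \<eta> o\<^sub>L (M n o\<^sub>L Mi (n + 1)))"
    by (auto simp: z' q intro!: blinfun_eqI)
qed

lemma iterate_pullback:
  "int_iterate (pullback A f) (int k) (x (m + int k), \<eta>) = (x m, \<eta> o\<^sub>L (M (m + int k) o\<^sub>L Mi m))"
proof -
  have "(pullback A f ^^ k) (x (m + int k), \<eta>) = (x m, \<eta> o\<^sub>L (M (m + int k) o\<^sub>L Mi m))"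
  \<comment> \<open>The innermost pullback is peeled off first and changes the covector, so \<eta>
    is generalised.\<close>
  proof (induction k arbitrary: \<eta>)
    case 0
    show ?case by (auto intro!: blinfun_eqI)
  next
    case (Suc k)
    have "(pullback A f ^^ Suc k) (x (m + int (Suc k)), \<eta>) =
        (pullback A f ^^ k) (x (m + int k), \<eta> o\<^sub>L (M (m + int k + 1) o\<^sub>L Mi (m + int k)))"
      using pullback_orbit[of "m + int k" \<eta>] by (simp add: funpow_Suc_right ac_simps del: funpow.simps)
    also have "\<dots> = (x m, \<eta> o\<^sub>L (M (m + int (Suc k)) o\<^sub>L Mi m))"
      unfolding Suc by (auto intro!: blinfun_eqI simp: ac_simps)
    finally show ?case .
  qed
  then show ?thesis by (simp add: int_iterate_def)
qed

lemma iterate_inv_pullback: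
  "int_iterate (pullback A f) (- int k) (x (m - int k), \<eta>) = (x m, \<eta> o\<^sub>L (M (m - int k) o\<^sub>L Mi m))"
proof -
  have "(inv (pullback A f) ^^ k) (x (m - int k), \<eta>) = (x m, \<eta> o\<^sub>L (M (m - int k) o\<^sub>L Mi m))"
  proof (induction k arbitrary: \<eta>)
    case 0
    show ?case by (auto intro!: blinfun_eqI)
  next
    case (Suc k)
    have e: "m - int (Suc k) + 1 = m - int k" by simp
    have "(inv (pullback A f) ^^ Suc k) (x (m - int (Suc k)), \<eta>) =
        (inv (pullback A f) ^^ k) (x (m - int k), \<eta> o\<^sub>L (M (m - int (Suc k)) o\<^sub>L Mi (m - int k)))"
      using inv_pullback_orbit[of "m - int (Suc k)" \<eta>] unfolding e by (simp add: funpow_Suc_right del: funpow.simps)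
    also have "\<dots> = (x m, \<eta> o\<^sub>L (M (m - int (Suc k)) o\<^sub>L Mi m))"
      unfolding Suc by (auto intro!: blinfun_eqI)
    finally show ?case .
  qed
  then show ?thesis by (simp add: int_iterate_def M_Mi)
qed

lemma expansion_term_s_nat:
  "expansion_term_s A f Vs Vu x \<omega> m (int k) = ((\<omega> (m + int k) o\<^sub>L M (m + int k)) o\<^sub>L P) o\<^sub>L Mi m"
  unfolding expansion_term_s_def coproj_along_def prod.case iterate_pullback
  by (rule blinfun_eqI) (simp add: proj_s)

lemma expansion_term_u_nat:
  "expansion_term_u A f Vs Vu x \<omega> m (- 1 - int k) =
    ((\<omega> (m - 1 - int k) o\<^sub>L M (m - 1 - int k)) o\<^sub>L Q) o\<^sub>L Mi m"
proof -
  \<comment> \<open>The natural index k stands for k + 1 steps of the inverse pullback.\<close>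
  have e: "- 1 - int k = - int (Suc k)" "m + - int (Suc k) = m - int (Suc k)" "m - 1 - int k = m - int (Suc k)"
    by simp_all
  show ?thesis
    unfolding e expansion_term_u_def coproj_along_def prod.case iterate_inv_pullback
    by (rule blinfun_eqI) (simp add: proj_u)
qed

text \<open>Both half-lines of integers are enumerated by naturals, and absolute convergence
  identifies the unordered sums with ordinary series. Composition with \<open>Mi m\<close> is
  bounded linear, so it moves out of the sums and onto the other side.\<close>

lemma expansion_formula_iff:
  assumes \<omega>: "\<omega> \<in> bounded_covecs g x"
  shows "expansion_formula A f Vs Vu x \<omega> \<nu> \<longleftrightarrow>
    (\<forall>m. \<nu> m o\<^sub>L M m = adjoint_series (\<lambda>n. \<omega> n o\<^sub>L M n) m)"
proof -
  let ?\<omega> = "\<lambda>n. \<omega> n o\<^sub>L M n"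
  have \<omega>': "bdd_covecs ?\<omega>" using \<omega> by (simp add: bdd_covecs_iff)
  have norm: "summable (\<lambda>k. norm (a k o\<^sub>L L))" if "summable (\<lambda>k. norm (a k))"
    for a :: "nat \<Rightarrow> 'e \<Rightarrow>\<^sub>L real" and L :: "'e \<Rightarrow>\<^sub>L 'e"
    by (rule summable_comparison_test'[OF summable_mult2[OF that, of "norm L"]])
      (simp add: norm_blinfun_compose)
  have sum: "(\<Sum>k. a k o\<^sub>L L) = (\<Sum>k. a k) o\<^sub>L L" if "summable (\<lambda>k. norm (a k))"
    for a :: "nat \<Rightarrow> 'e \<Rightarrow>\<^sub>L real" and L :: "'e \<Rightarrow>\<^sub>L 'e"
    by (rule bounded_linear.suminf[OF bounded_bilinear.bounded_linear_left[OF bounded_bilinear_blinfun_compose]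
          summable_norm_cancel[OF that], symmetric])
  have bij_s: "bij_betw int UNIV {0..}"
    by (rule bij_betwI[where g = nat]) auto
  have bij_u: "bij_betw (\<lambda>k. - 1 - int k) UNIV {..-1}"
    by (rule bij_betwI[where g = "\<lambda>i. nat (- 1 - i)"]) auto
  have s: "(expansion_term_s A f Vs Vu x \<omega> m has_sum ((\<Sum>k. ?\<omega> (m + int k) o\<^sub>L P) o\<^sub>L Mi m)) {0..}" for m
    unfolding sum[OF adjoint_series_summable(1)[OF \<omega>'], symmetric]
    by (rule has_sum_nat_reindex, rule norm, rule adjoint_series_summable(1)[OF \<omega>'],
        rule bij_s, rule expansion_term_s_nat)
  have u: "(expansion_term_u A f Vs Vu x \<omega> m has_sum ((\<Sum>k. ?\<omega> (m - 1 - int k) o\<^sub>L Q) o\<^sub>L Mi m)) {..-1}" for m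
    unfolding sum[OF adjoint_series_summable(2)[OF \<omega>'], symmetric]
    by (rule has_sum_nat_reindex, rule norm, rule adjoint_series_summable(2)[OF \<omega>'],
        rule bij_u, rule expansion_term_u_nat)
  have "expansion_formula A f Vs Vu x \<omega> \<nu> \<longleftrightarrow> (\<forall>m. \<nu> m = adjoint_series ?\<omega> m o\<^sub>L Mi m)"
    unfolding expansion_formula_def infsumI[OF s] infsumI[OF u] adjoint_series_def[OF \<omega>']
    using has_sum_imp_summable[OF s] has_sum_imp_summable[OF u]
    by (simp add: bounded_bilinear.diff_left[OF bounded_bilinear_blinfun_compose])
  also have "\<dots> \<longleftrightarrow> (\<forall>m. \<nu> m o\<^sub>L M m = adjoint_series ?\<omega> m)"
    by (simp only: eq_compose_Mi_iff)
  finally show ?thesis .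
qed

text \<open>Any bounded solution of the shadowing equation becomes a bounded solution of the
  translated equation in the frame, where uniqueness holds; this resolves the definite
  description.\<close>

lemma shadowing_eq:
  assumes "bdd_vecs v" "\<And>n. v (n + 1) = v n + Mi (n + 1) (X (n + 1))"
  shows "shadowing A g f x X = (\<lambda>n. M n (v n))"
  unfolding shadowing_def
proof (rule the_equality)
  have "M (n + 1) (v (n + 1)) = differential A f (x n) (M n (v n)) + X (n + 1)" for n
    by (simp add: assms(2) blinfun.add_right M_step_apply)
  moreover have "(\<lambda>n. M n (v n)) \<in> bounded_vecs g x"
    using bdd_vecs_iff[of "\<lambda>n. M n (v n)"] assms(1) by simp
  ultimately show "(\<lambda>n. M n (v n)) \<in> bounded_vecs g x \<and>
      (\<forall>n. M (n + 1) (v (n + 1)) = differential A f (x n) (M n (v n)) + X (n + 1))" by blast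
next
  fix w assume w: "w \<in> bounded_vecs g x \<and> (\<forall>n. w (n + 1) = differential A f (x n) (w n) + X (n + 1))"
  have "(\<lambda>n. Mi n (w n)) = v"
  proof (rule shadow_unique[where X = "\<lambda>n. Mi n (X n)"])
    show "bdd_vecs (\<lambda>n. Mi n (w n))" using w by (simp add: bdd_vecs_iff)
    show "Mi (n + 1) (w (n + 1)) = Mi n (w n) + Mi (n + 1) (X (n + 1))" for n
      using w by (simp add: differential_eq blinfun.add_right)
  qed (rule assms)+
  then have "Mi n (w n) = v n" for n by (rule fun_cong)
  then show "w = (\<lambda>n. M n (v n))" by (metis M_Mi_apply)
qed

end

section \<open>The characterizations for an orbit on the attractor\<close>

theorem lemma4:
  fixes A :: "('m::{t2_space,second_countable_topology}, 'e::euclidean_space) chart set"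
    and g :: "'m \<Rightarrow> 'e \<Rightarrow> 'e \<Rightarrow> real"
    and f :: "'m \<Rightarrow> 'm"
    and K :: "'m set"
    and Vs Vu :: "'m \<Rightarrow> 'e set"
    and x :: "int \<Rightarrow> 'm"
    and \<omega> \<nu> :: "int \<Rightarrow> 'e \<Rightarrow>\<^sub>L real"
  assumes "smooth_atlas A" and "riemannian_metric A g"
    and "diffeomorphism A f"
    and "compact K" and "hyperbolic_set A g f K Vs Vu" and "attractor f K"
    and "\<And>n. x n \<in> K" and "\<And>n. x (n + 1) = f (x n)"
    and "\<omega> \<in> bounded_covecs g x" and "\<nu> \<in> bounded_covecs g x"
  shows "((adjoint_solution A g f x \<omega> \<nu> \<and>
            (\<forall>\<nu>'. adjoint_solution A g f x \<omega> \<nu>' \<longrightarrow> \<nu>' = \<nu>))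
          \<longleftrightarrow> expansion_formula A f Vs Vu x \<omega> \<nu>) \<and>
    (expansion_formula A f Vs Vu x \<omega> \<nu> \<longrightarrow>
      (\<forall>X \<in> bounded_vecs g x.
        (\<lambda>T::nat.
            1 / (2 * real T + 1) *
              (\<Sum>n = - int T..int T. blinfun_apply (\<omega> n) (shadowing A g f x X n))
          - 1 / (2 * real T + 1) *
              (\<Sum>n = - int T..int T. blinfun_apply (\<nu> n) (X n)))
        \<longlonglongrightarrow> 0))"
proof -
  note hyp = assms(5)[unfolded hyperbolic_set_def]
  note K = assms(7) and step = assms(8)
  have compl: "complementary (Vs p) (Vu p)" if "p \<in> K" for p
    using hyp that unfolding complementary_def by blast
  have inv_s: "blinfun_apply (differential A f p) ` Vs p = Vs (f p)"
    and inv_u: "blinfun_apply (differential A f p) ` Vu p = Vu (f p)" if "p \<in> K" for p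
    using hyp that by blast+
  have sub: "continuous_subbundle A K Vs" "continuous_subbundle A K Vu" using hyp by blast+
  obtain C r where C: "C > 0" and r: "0 < r" "r < 1"
    and est0: "\<forall>p\<in>K. \<forall>n::nat.
           (\<forall>v\<in>Vu p. vec_norm g (int_iterate (pushforward A f) (- int n) (p, v))
              \<le> C * r ^ n * vec_norm g (p, v)) \<and>
           (\<forall>v\<in>Vs p. vec_norm g (int_iterate (pushforward A f) (int n) (p, v))
              \<le> C * r ^ n * vec_norm g (p, v))"
    using hyp by (elim conjE exE) (rule that)
  have est: "vec_norm g (int_iterate (pushforward A f) (- int n) (p, v)) \<le> C * r ^ n * vec_norm g (p, v)"
    if "p \<in> K" "v \<in> Vu p" for p n v
    using est0 that by blast
  have est': "vec_norm g (int_iterate (pushforward A f) (int n) (p, v)) \<le> C * r ^ n * vec_norm g (p, v)"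
    if "p \<in> K" "v \<in> Vs p" for p n v
    using est0 that by blast
  obtain B1 where B1: "B1 > 0"
    "\<And>p a b. p \<in> K \<Longrightarrow> a \<in> Vs p \<Longrightarrow> b \<in> Vu p \<Longrightarrow> vec_norm g (p, a) \<le> B1 * vec_norm g (p, a + b)"
    using subbundle_angle[OF assms(1,2,4) sub compl] by blast
  obtain B2 where B2: "B2 > 0"
    "\<And>p a b. p \<in> K \<Longrightarrow> a \<in> Vs p \<Longrightarrow> b \<in> Vu p \<Longrightarrow> vec_norm g (p, b) \<le> B2 * vec_norm g (p, a + b)"
    using subbundle_angle[OF assms(1,2,4) sub(2,1) complementary_sym[OF compl]] by (metis add.commute)
  \<comment> \<open>Both summands of the target fibre are images of the corresponding subspaces at
    \<open>x n\<close>.\<close>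
  have surj: "surj (blinfun_apply (differential A f (x n)))" for n
    unfolding surj_def
  proof
    fix w
    obtain a b where "a \<in> Vs (f (x n))" "b \<in> Vu (f (x n))" "w = a + b"
      using compl[OF K[of "n + 1"]] unfolding step complementary_def by blast
    then obtain a' b' where "a = differential A f (x n) a'" "b = differential A f (x n) b'"
      using inv_s[OF K] inv_u[OF K] by blast
    with \<open>w = a + b\<close> show "\<exists>v. w = differential A f (x n) v"
      by (intro exI[of _ "a' + b'"]) (simp add: blinfun.add_right)
  qed
  obtain M Mi :: "int \<Rightarrow> 'e \<Rightarrow>\<^sub>L 'e" where M:
    "\<And>n. M (n + 1) = differential A f (x n) o\<^sub>L M n" "\<And>n. Mi n o\<^sub>L M n = id_blinfun" "\<And>n. M n o\<^sub>L Mi n = id_blinfun"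
    using orbit_frame_exists[of "\<lambda>n. differential A f (x n)", OF surj] by blast
  \<comment> \<open>The sum of the two angle constants bounds both projections.\<close>
  interpret framed_orbit A g f Vs Vu x M Mi C r "B1 + B2"
  proof
    show "bij f" using assms(3) by (simp add: diffeomorphism_def)
    show "differential A f (x n) ` Vs (x n) = Vs (x (n + 1))" "differential A f (x n) ` Vu (x n) = Vu (x (n + 1))" for n
      using inv_s[OF K] inv_u[OF K] by (simp_all add: step)
    show "B1 + B2 > 0" using B1(1) B2(1) by simp
    fix n a b assume ab: "a \<in> Vs (x n)" "b \<in> Vu (x n)"
    have "B1 * vec_norm g (x n, a + b) \<le> (B1 + B2) * vec_norm g (x n, a + b)"
      "B2 * vec_norm g (x n, a + b) \<le> (B1 + B2) * vec_norm g (x n, a + b)"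
      using B1(1) B2(1) by (auto intro!: mult_right_mono vec_norm_nonneg[OF assms(2)])
    then show "vec_norm g (x n, a) \<le> (B1 + B2) * vec_norm g (x n, a + b)"
      "vec_norm g (x n, b) \<le> (B1 + B2) * vec_norm g (x n, a + b)"
      using B1(2)[OF K ab] B2(2)[OF K ab] by linarith+
  qed (rule assms(2) step compl K M C r est est' | assumption)+

  let ?\<omega> = "\<lambda>n. \<omega> n o\<^sub>L M n" and ?\<nu> = "\<lambda>n. \<nu> n o\<^sub>L M n"
  have bdd: "bdd_covecs ?\<omega>" "bdd_covecs ?\<nu>" using assms(9,10) by (simp_all add: bdd_covecs_iff)
  have adj: "adjoint_solution A g f x \<omega> \<nu>' \<longleftrightarrow> \<nu>' \<in> bounded_covecs g x \<and>
      (\<forall>n. \<nu>' n o\<^sub>L M n = (\<nu>' (n + 1) o\<^sub>L M (n + 1)) + ?\<omega> n)" for \<nu>'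
    unfolding adjoint_solution_def adjoint_equation_iff ..
  have iff: "adjoint_solution A g f x \<omega> \<nu> \<longleftrightarrow> expansion_formula A f Vs Vu x \<omega> \<nu>"
    unfolding adj expansion_formula_iff[OF assms(9)]
    using adjoint_solution_iff_series[OF bdd] assms(10) by blast
  \<comment> \<open>Supplies the uniqueness clause of (c): both solutions are compared in the frame,
    and the frame is then cancelled.\<close>
  have unique: "\<nu>' = \<nu>" if "adjoint_solution A g f x \<omega> \<nu>" "adjoint_solution A g f x \<omega> \<nu>'" for \<nu>'
  proof
    fix n
    have "(\<lambda>n. \<nu>' n o\<^sub>L M n) = ?\<nu>"
    proof (rule adjoint_unique[where \<omega> = ?\<omega>])
      show "bdd_covecs (\<lambda>n. \<nu>' n o\<^sub>L M n)" using that(2) unfolding adj bdd_covecs_iff by blast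
      show "\<nu>' n o\<^sub>L M n = (\<nu>' (n + 1) o\<^sub>L M (n + 1)) + ?\<omega> n" for n using that(2) unfolding adj by blast
      show "?\<nu> n = ?\<nu> (n + 1) + ?\<omega> n" for n using that(1) unfolding adj by blast
    qed (rule bdd(2))
    then have "\<nu>' n o\<^sub>L M n = \<nu> n o\<^sub>L M n" by (rule fun_cong)
    then show "\<nu>' n = \<nu> n" by (simp only: compose_M_cancel)
  qed
  \<comment> \<open>Derived from the adjoint equation, since that is what makes the sum telescope;
    \<open>iff\<close> then replaces this premise by the expansion formula.\<close>
  have average: "(\<lambda>T::nat. 1 / (2 * real T + 1) * (\<Sum>n = - int T..int T. \<omega> n (shadowing A g f x X n))
      - 1 / (2 * real T + 1) * (\<Sum>n = - int T..int T. \<nu> n (X n))) \<longlonglongrightarrow> 0"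
    if sol: "adjoint_solution A g f x \<omega> \<nu>" and X: "X \<in> bounded_vecs g x" for X
  proof -
    have X': "bdd_vecs (\<lambda>n. Mi n (X n))" using X by (simp add: bdd_vecs_iff)
    obtain v where v: "bdd_vecs v" "\<And>n. v (n + 1) = v n + Mi (n + 1) (X (n + 1))"
      using shadow_exists[OF X'] by blast
    have "?\<nu> n = ?\<nu> (n + 1) + ?\<omega> n" for n using sol unfolding adj by blast
    from telescoping_average[OF bdd(2) this X' v]
    show ?thesis by (simp add: shadowing_eq[where X = X, OF v])
  qed
  show ?thesis using iff unique average by blast
qed

end
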